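(* Let $d\ge1$ and let $I_d\subset\mathbb{K}[x_0,\dots,x_d]$ be the ideal of $2\times2$ minors of the generic Hankel matrix $X_1$. Any diagonal term order $\prec$ is delightful for $I_d$. For every $r\ge1$, the $(r+1)\times(r+1)$ minors of the Hankel matrix $X_r$ generate $I_d^{\{r\}}$ and form a Gröbner basis of it with respect to $\prec$.
   Context: $\mathbb{K}$ is an algebraically closed field. For $1\le r\le d$, $X_r$ is the $(r+1)\times(d-r+1)$ Hankel matrix whose entry in row $a$ and column $b$ ($0\le a\le r$, $0\le b\le d-r$) is $x_{a+b}$. If $X_r$ has no $(r+1)\times(r+1)$ minors (i.e. $2r>d$), the set of minors is empty and generates the zero ideal. A diagonal term order here is any term order that selects the product of the main diagonal entries as leading monomial of every maximal minor of the matrices $X_r$ (for instance the lexicographic order with $x_0\succ x_1\succ\cdots\succ x_d$). Join and secant ideals: $I\ast J=\big(I(\mathbf{y})+J(\mathbf{z})+\langle x_i-y_i-z_i\mid i\rangle\big)\cap\mathbb{K}[\mathbf{x}]$, where $I(\mathbf{y})$ is $I$ with $y_i$ substituted for $x_i$; the $r$-th secant ideal is the $r$-fold join $I^{\{r\}}=I\ast\cdots\ast I$ (so $I^{\{1\}}=I$). A term order $\prec$ is delightful for $I$ if $\mathrm{in}_\prec(I^{\{r\}})=\mathrm{in}_\prec(I)^{\{r\}}$ for all $r\ge1$. *)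

theory Defs
  imports
    "HOL-Computational_Algebra.Polynomial"
    "HOL-Library.Poly_Mapping"
    "HOL-Algebra.Ideal"
    "Jordan_Normal_Form.Determinant"
    "Jordan_Normal_Form.DL_Submatrix"
begin

section \<open>Polynomial rings over a set of variables\<close>

text \<open>
  Monomials are exponent vectors, i.e. finitely supported functions \<open>'v \<Rightarrow>\<^sub>0 nat\<close>; polynomials
  are finitely supported functions from monomials to coefficients.  The product that
  \<open>HOL-Library.Poly_Mapping\<close> puts on the latter is convolution, i.e. polynomial multiplication.
\<close>

type_synonym 'v monomial = "'v \<Rightarrow>\<^sub>0 nat"
type_synonym ('v, 'k) mpoly = "'v monomial \<Rightarrow>\<^sub>0 'k"

definition monomials :: "'v set \<Rightarrow> 'v monomial set" where
  "monomials V = {m. Poly_Mapping.keys m \<subseteq> V}"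

definition mpoly_ring :: "'v set \<Rightarrow> ('v, 'k::comm_ring_1) mpoly ring" where
  "mpoly_ring V =
    \<lparr>carrier = {p. Poly_Mapping.keys p \<subseteq> monomials V}, monoid.mult = (*), one = 1,
     zero = 0, add = (+)\<rparr>"

definition Monom :: "'v monomial \<Rightarrow> ('v, 'k::comm_ring_1) mpoly" where
  "Monom m = Poly_Mapping.single m 1"

definition Var :: "'v \<Rightarrow> ('v, 'k::comm_ring_1) mpoly" where
  "Var v = Monom (Poly_Mapping.single v 1)"

definition Const :: "'k \<Rightarrow> ('v, 'k::comm_ring_1) mpoly" where
  "Const c = Poly_Mapping.single 0 c"

text \<open>Substitution of the polynomials \<open>\<sigma> v\<close> for the variables \<open>v\<close>.\<close>

definition subst_vars :: "('v \<Rightarrow> ('w, 'k) mpoly) \<Rightarrow> ('v, 'k::comm_ring_1) mpoly \<Rightarrow> ('w, 'k) mpoly" where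
  "subst_vars \<sigma> p = (\<Sum>m\<in>Poly_Mapping.keys p. Const (Poly_Mapping.lookup p m) *
      (\<Prod>v\<in>Poly_Mapping.keys m. \<sigma> v ^ Poly_Mapping.lookup m v))"

lemma cring_mpoly_ring: "cring (mpoly_ring V :: ('v, 'k::comm_ring_1) mpoly ring)"
proof (rule cringI)
  let ?R = "mpoly_ring V :: ('v, 'k) mpoly ring"
  have add: "p + q \<in> carrier ?R" if "p \<in> carrier ?R" "q \<in> carrier ?R" for p q
    using that Poly_Mapping.keys_add[of p q] by (auto simp: mpoly_ring_def)
  have mult: "p * q \<in> carrier ?R" if "p \<in> carrier ?R" "q \<in> carrier ?R" for p q
  proof -
    have "m + n \<in> monomials V" if "m \<in> monomials V" "n \<in> monomials V" for m n :: "'v monomial"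
      using that Poly_Mapping.keys_add[of m n] by (auto simp: monomials_def)
    then show ?thesis
      using that Poly_Mapping.keys_mult[of p q] by (fastforce simp: mpoly_ring_def)
  qed
  show "abelian_group ?R"
  proof (rule abelian_groupI)
    fix p assume "p \<in> carrier ?R"
    then show "\<exists>q\<in>carrier ?R. q \<oplus>\<^bsub>?R\<^esub> p = \<zero>\<^bsub>?R\<^esub>"
      by (intro bexI[of _ "- p"]) (auto simp: mpoly_ring_def)
  qed (use add in \<open>auto simp: mpoly_ring_def algebra_simps\<close>)
  show "comm_monoid ?R"
    by (rule comm_monoidI) (use mult in \<open>auto simp: mpoly_ring_def monomials_def algebra_simps\<close>)
qed (auto simp: mpoly_ring_def algebra_simps)


section \<open>Term orders, initial ideals and Groebner bases\<close>

text \<open>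
  A pair \<open>(m, n) \<in> ord\<close> means that \<open>m\<close> is smaller than or equal to \<open>n\<close>.
\<close>

definition term_order :: "'v set \<Rightarrow> 'v monomial rel \<Rightarrow> bool" where
  "term_order V ord \<longleftrightarrow>
     linear_order_on (monomials V) ord \<and>
     (\<forall>m\<in>monomials V. (0, m) \<in> ord) \<and>
     (\<forall>m n. (m, n) \<in> ord \<longrightarrow> (\<forall>k\<in>monomials V. (m + k, n + k) \<in> ord))"

text \<open>
  The leading monomial, without its coefficient; only meaningful for nonzero polynomials.
\<close>

definition lead_mono :: "'v monomial rel \<Rightarrow> ('v, 'k::comm_ring_1) mpoly \<Rightarrow> ('v, 'k) mpoly" where
  "lead_mono ord p =
     Monom (THE m. m \<in> Poly_Mapping.keys p \<and> (\<forall>n\<in>Poly_Mapping.keys p. (n, m) \<in> ord))"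

definition initial_ideal ::
  "'v set \<Rightarrow> 'v monomial rel \<Rightarrow> ('v, 'k::comm_ring_1) mpoly set \<Rightarrow> ('v, 'k) mpoly set" where
  "initial_ideal V ord I = genideal (mpoly_ring V) {lead_mono ord f |f. f \<in> I \<and> f \<noteq> 0}"

definition groebner_basis :: "'v set \<Rightarrow> 'v monomial rel \<Rightarrow>
    ('v, 'k::comm_ring_1) mpoly set \<Rightarrow> ('v, 'k) mpoly set \<Rightarrow> bool" where
  "groebner_basis V ord I G \<longleftrightarrow>
     finite G \<and> G \<subseteq> I \<and>
     initial_ideal V ord I = genideal (mpoly_ring V) {lead_mono ord g |g. g \<in> G \<and> g \<noteq> 0}"


section \<open>Joins, secant ideals and delightful term orders\<close>

text \<open>Three copies \<open>x\<^sub>v\<close>, \<open>y\<^sub>v\<close>, \<open>z\<^sub>v\<close> of every variable \<open>v\<close>.\<close>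

datatype 'v xyz = Xv 'v | Yv 'v | Zv 'v

definition join_ideal :: "'v set \<Rightarrow> ('v, 'k::comm_ring_1) mpoly set \<Rightarrow> ('v, 'k) mpoly set
    \<Rightarrow> ('v, 'k) mpoly set" where
  "join_ideal V I J =
     {p \<in> carrier (mpoly_ring V).
        subst_vars (\<lambda>v. Var (Xv v)) p \<in>
          genideal (mpoly_ring (Xv ` V \<union> Yv ` V \<union> Zv ` V))
            (subst_vars (\<lambda>v. Var (Yv v)) ` I \<union> subst_vars (\<lambda>v. Var (Zv v)) ` J \<union>
             {Var (Xv v) - Var (Yv v) - Var (Zv v) |v. v \<in> V})}"

text \<open>
  The \<open>r\<close>-fold join of \<open>I\<close> with itself for \<open>r \<ge> 1\<close>; the value at \<open>r = 0\<close> has no meaning.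
\<close>

definition secant_ideal :: "'v set \<Rightarrow> ('v, 'k::comm_ring_1) mpoly set \<Rightarrow> nat
    \<Rightarrow> ('v, 'k) mpoly set" where
  "secant_ideal V I r = ((\<lambda>J. join_ideal V J I) ^^ (r - 1)) I"

definition delightful :: "'v set \<Rightarrow> 'v monomial rel \<Rightarrow> ('v, 'k::comm_ring_1) mpoly set \<Rightarrow> bool" where
  "delightful V ord I \<longleftrightarrow>
     (\<forall>r\<ge>1. initial_ideal V ord (secant_ideal V I r) = secant_ideal V (initial_ideal V ord I) r)"


section \<open>Minors of Hankel matrices\<close>

definition square_submatrices :: "nat \<Rightarrow> 'a mat \<Rightarrow> 'a mat set" where
  "square_submatrices k A =
     {submatrix A I J |I J. I \<subseteq> {..<dim_row A} \<and> J \<subseteq> {..<dim_col A} \<and> card I = k \<and> card J = k}"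

definition minors :: "nat \<Rightarrow> 'a::comm_ring_1 mat \<Rightarrow> 'a set" where
  "minors k A = det ` square_submatrices k A"

text \<open>
  For \<open>r > d\<close> truncated subtraction makes this a matrix without columns, hence without
  \<open>(r + 1) \<times> (r + 1)\<close> minors.
\<close>

definition hankel :: "nat \<Rightarrow> nat \<Rightarrow> (nat, 'k::comm_ring_1) mpoly mat" where
  "hankel d r = mat (r + 1) (d + 1 - r) (\<lambda>(a, b). Var (a + b))"

definition hankel_ideal :: "nat \<Rightarrow> (nat, 'k::comm_ring_1) mpoly set" where
  "hankel_ideal d = genideal (mpoly_ring {..d}) (minors 2 (hankel d 1))"

text \<open>
  The field \<open>'k\<close> is an argument because the leading monomials are those of minors with
  coefficients in \<open>'k\<close>.
\<close>

definition diagonal_term_order :: "'k::comm_ring_1 itself \<Rightarrow> nat \<Rightarrow> nat monomial rel \<Rightarrow> bool" where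
  "diagonal_term_order _ d ord \<longleftrightarrow>
     term_order {..d} ord \<and>
     (\<forall>r\<in>{1..d}. \<forall>M\<in>square_submatrices (min (r + 1) (d + 1 - r))
                        (hankel d r :: (nat, 'k) mpoly mat).
        lead_mono ord (det M) = (\<Prod>i<dim_row M. M $$ (i, i)))"

end

theory Submission
  imports Defs
begin

text \<open>
  Call a set of indices separated if its elements differ pairwise by at least two, and let
  \<open>C\<^sub>r\<close> be the monomial ideal of the separated sets of size \<open>r + 1\<close>; its generators are exactly the
  diagonal products of the maximal minors of \<open>X\<^sub>r\<close>.  Writing \<open>D\<^sub>r\<close> for the ideal of these minors and \<open>I\<close>
  for \<open>D\<^sub>1\<close>, there is a chain
  \<open>C\<^sub>r \<subseteq> in(D\<^sub>r) \<subseteq> in(I\<^bsup>{r}\<^esup>) \<subseteq> in(I)\<^bsup>{r}\<^esup> \<subseteq> C\<^sub>r\<close>,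
  so that equality holds throughout, and \<open>D\<^sub>r = I\<^bsup>{r}\<^esup>\<close> because they are nested with equal initial ideals.
  The third inclusion holds for joins of arbitrary ideals over a field.  For the last one,
  \<open>in(I) \<subseteq> C\<^sub>1\<close> since a monomial \<open>x\<^sub>i\<^sup>a x\<^sub>i\<^sub>+\<^sub>1\<^sup>b\<close> is the smallest one of its degree and weight, and
  joining with \<open>C\<^sub>1\<close> raises \<open>r\<close> by one: peel off the smallest variable of a monomial and its successor.
\<close>

text \<open>A secant ideal is defined by elimination, so neither generators nor initial ideal are at
  hand. Nothing is eliminated here: joins are bounded from above by substituting for y and z
  (\<open>subst_vars_join_ideal\<close>) and from below by replacing x with y + z
  (\<open>join_idealI\<close>). Nor is the term order extended to x, y, z; initial ideals of joins
  are compared dually, through linear functionals on polynomials. The diagonal hypothesis enters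
  twice: leading monomials of maximal minors give the bottom of the chain, and for 2 x 2 minors it
  says that moving two indices closer together makes a monomial smaller, which gives the top. A
  separated set s_0 < ... < s_r is the diagonal of the minor with columns s_k - k; gaps of at least
  two make these columns increase strictly. In particular s_r >= 2 r, so for 2 r > d there are
  neither separated sets nor minors, C_r is zero, and this case needs no separate treatment. The
  ideal of the leading monomials of the minors lies between C_r and in(D_r), so the collapse of the
  chain also yields the Groebner basis.\<close>

abbreviation (input) "keys \<equiv> Poly_Mapping.keys"
abbreviation (input) "lookup \<equiv> Poly_Mapping.lookup"

subsection \<open>Linear extension and substitution\<close>

text \<open>Covers two uses at once: \<open>g = Const\<close> gives substitution homomorphisms, and
  the identity for \<open>g\<close> gives linear functionals with prescribed values on
  monomials.\<close>

definition lin :: "('k \<Rightarrow> 'b) \<Rightarrow> ('m \<Rightarrow> 'b) \<Rightarrow> ('m \<Rightarrow>\<^sub>0 'k::zero) \<Rightarrow> 'b::comm_ring_1" where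
  "lin g \<tau> p = (\<Sum>m\<in>keys p. g (lookup p m) * \<tau> m)"

lemma poly_mapping_sum_single:
  "(\<Sum>m\<in>keys p. Poly_Mapping.single m (lookup p m)) = (p :: 'm \<Rightarrow>\<^sub>0 'k::comm_monoid_add)"
proof (rule poly_mapping_eqI)
  fix k
  have "lookup (\<Sum>m\<in>keys p. Poly_Mapping.single m (lookup p m)) k
      = (\<Sum>m\<in>keys p. if m = k then lookup p m else 0)"
    by (simp add: lookup_sum lookup_single when_def)
  also have "\<dots> = lookup p k"
    by (simp add: in_keys_iff)
  finally show "lookup (\<Sum>m\<in>keys p. Poly_Mapping.single m (lookup p m)) k = lookup p k" .
qed

lemma lin_superset:
  assumes "finite A" "keys p \<subseteq> A" "g 0 = 0"
  shows "lin g \<tau> p = (\<Sum>m\<in>A. g (lookup p m) * \<tau> m)"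
  unfolding lin_def
  by (rule sum.mono_neutral_left) (use assms in \<open>auto simp: in_keys_iff\<close>)

lemma lin_single: "g 0 = 0 \<Longrightarrow> lin g \<tau> (Poly_Mapping.single m c) = g c * \<tau> m"
  by (cases "c = 0") (auto simp: lin_def)

lemma lin_zero [simp]: "lin g \<tau> 0 = 0"
  by (simp add: lin_def)

context
  fixes g :: "'k::comm_ring_1 \<Rightarrow> 'b::comm_ring_1"
  assumes g: "comm_ring_hom g"
begin

interpretation g: comm_ring_hom g by (rule g)

lemma lin_add: "lin g \<tau> (p + q) = lin g \<tau> p + lin g \<tau> q"
  using lin_superset[of "keys p \<union> keys q" p g \<tau>] lin_superset[of "keys p \<union> keys q" q g \<tau>]
    lin_superset[of "keys p \<union> keys q" "p + q" g \<tau>] Poly_Mapping.keys_add[of p q]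
  by (simp add: lookup_add g.hom_add algebra_simps sum.distrib)

lemma lin_sum: "lin g \<tau> (sum f A) = (\<Sum>i\<in>A. lin g \<tau> (f i))"
  by (induction A rule: infinite_finite_induct) (auto simp: lin_add)

lemma lin_uminus: "lin g \<tau> (- p) = - lin g \<tau> p"
  using lin_add[of \<tau> p "- p"] by (simp add: eq_neg_iff_add_eq_0 add.commute)

lemma lin_diff: "lin g \<tau> (p - q) = lin g \<tau> p - lin g \<tau> q"
  using lin_add[of \<tau> p "- q"] by (simp add: lin_uminus)

text \<open>Here \<open>\<tau>\<close> need not be multiplicative: a monomial factor shifts the
  argument of \<open>\<tau>\<close>. This is the product rule for functionals that are not ring
  homomorphisms.\<close>

lemma lin_times_left:
  "lin g \<tau> (p * q) = (\<Sum>m\<in>keys p. g (lookup p m) * lin g (\<lambda>n. \<tau> (m + n)) q)"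
proof -
  have "p * q = (\<Sum>m\<in>keys p. Poly_Mapping.single m (lookup p m)) *
                (\<Sum>n\<in>keys q. Poly_Mapping.single n (lookup q n))"
    by (simp add: poly_mapping_sum_single)
  also have "\<dots> = (\<Sum>m\<in>keys p. \<Sum>n\<in>keys q. Poly_Mapping.single (m + n) (lookup p m * lookup q n))"
    by (simp add: sum_product mult_single)
  finally show ?thesis
    by (simp add: lin_sum lin_single g.hom_mult)
       (simp add: lin_def sum_distrib_left mult.assoc)
qed

lemma lin_times:
  assumes "\<And>m n. \<tau> (m + n) = \<tau> m * \<tau> n"
  shows "lin g \<tau> (p * q) = lin g \<tau> p * lin g \<tau> q"
  unfolding lin_times_left assms
  unfolding lin_def sum_product by (simp add: sum_distrib_left mult_ac)

end

lemma comm_ring_hom_Const: "comm_ring_hom (Const :: 'k::comm_ring_1 \<Rightarrow> ('v,'k) mpoly)"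
  by unfold_locales (auto simp: Const_def single_add mult_single)

lemma comm_ring_hom_id: "comm_ring_hom (\<lambda>c::'k::comm_ring_1. c)"
  by unfold_locales auto

definition monom_subst :: "('v \<Rightarrow> 'b) \<Rightarrow> 'v monomial \<Rightarrow> 'b::comm_monoid_mult" where
  "monom_subst \<sigma> m = (\<Prod>v\<in>keys m. \<sigma> v ^ lookup m v)"

lemma monom_subst_superset:
  assumes "finite A" "keys m \<subseteq> A"
  shows "monom_subst \<sigma> m = (\<Prod>v\<in>A. \<sigma> v ^ lookup m v)"
  unfolding monom_subst_def
  by (rule prod.mono_neutral_left) (use assms in \<open>auto simp: in_keys_iff\<close>)

lemma monom_subst_plus: "monom_subst \<sigma> (m + n) = monom_subst \<sigma> m * monom_subst \<sigma> n"
  using monom_subst_superset[of "keys m \<union> keys n" m \<sigma>] monom_subst_superset[of "keys m \<union> keys n" n \<sigma>]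
    monom_subst_superset[of "keys m \<union> keys n" "m + n" \<sigma>] Poly_Mapping.keys_add[of m n]
  by (simp add: lookup_add power_add prod.distrib)

lemma monom_subst_zero [simp]: "monom_subst \<sigma> 0 = 1"
  by (simp add: monom_subst_def)

lemma monom_subst_single [simp]: "monom_subst \<sigma> (Poly_Mapping.single v k) = \<sigma> v ^ k"
  by (simp add: monom_subst_def)

lemma subst_vars_eq_lin: "subst_vars \<sigma> p = lin Const (monom_subst \<sigma>) p"
  by (simp add: subst_vars_def lin_def monom_subst_def)

lemma Const_zero [simp]: "Const 0 = 0" and Const_one [simp]: "Const 1 = 1"
  by (simp_all add: Const_def)

lemma comm_ring_hom_subst_vars:
  "comm_ring_hom (subst_vars \<sigma> :: ('v,'k::comm_ring_1) mpoly \<Rightarrow> ('w,'k) mpoly)"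
proof
  show "subst_vars \<sigma> 1 = (1 :: ('w,'k) mpoly)"
    unfolding subst_vars_eq_lin by (subst single_one[symmetric], subst lin_single) auto
qed (auto simp: subst_vars_eq_lin lin_add[OF comm_ring_hom_Const]
        lin_times[OF comm_ring_hom_Const] monom_subst_plus)

lemma subst_vars_Monom [simp]: "subst_vars \<sigma> (Monom m) = monom_subst \<sigma> m"
  by (simp add: subst_vars_eq_lin Monom_def lin_single)

lemma subst_vars_Var [simp]: "subst_vars \<sigma> (Var v) = \<sigma> v"
  by (simp add: Var_def)

lemma subst_vars_Const [simp]: "subst_vars \<sigma> (Const c) = Const c"
  by (simp add: subst_vars_eq_lin Const_def lin_single)

lemma Const_times_Monom: "Const c * Monom m = Poly_Mapping.single m c"
  by (simp add: Const_def Monom_def mult_single)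

lemma mpoly_eq_sum_Monom: "p = (\<Sum>m\<in>keys p. Const (lookup p m) * Monom m)"
  by (simp add: Const_times_Monom poly_mapping_sum_single)

lemma Monom_times: "Monom m * Monom n = Monom (m + n)"
  by (simp add: Monom_def mult_single)

lemma Monom_zero [simp]: "Monom 0 = 1"
  by (simp add: Monom_def)

lemma keys_Monom [simp]: "keys (Monom m :: ('v,'k::comm_ring_1) mpoly) = {m}"
  by (simp add: Monom_def)

lemma Monom_inject [simp]: "(Monom m :: ('v,'k::comm_ring_1) mpoly) = Monom n \<longleftrightarrow> m = n"
  by (metis keys_Monom singleton_inject)

lemma Monom_sum: "Monom (sum f A) = (\<Prod>i\<in>A. Monom (f i))"
  by (induction A rule: infinite_finite_induct) (auto simp: Monom_times[symmetric])

lemma Monom_eq_prod_Var: "Monom m = monom_subst Var m"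
proof -
  have eq: "Monom (Poly_Mapping.single v k) = (Var v :: ('a,'b) mpoly) ^ k" for v k
  proof (induction k)
    case (Suc k)
    have "Poly_Mapping.single v (Suc k) = Poly_Mapping.single v 1 + Poly_Mapping.single v k"
      by (simp flip: single_add)
    then show ?case by (simp add: Suc[symmetric]) (simp add: Var_def Monom_times)
  qed simp
  have "Monom m = (Monom (\<Sum>v\<in>keys m. Poly_Mapping.single v (lookup m v)) :: ('a,'b) mpoly)"
    by (simp add: poly_mapping_sum_single)
  then show ?thesis
    by (simp add: Monom_sum eq monom_subst_def)
qed

lemma subst_vars_subst_vars:
  "subst_vars \<sigma> (subst_vars \<tau> p) = subst_vars (\<lambda>v. subst_vars \<sigma> (\<tau> v)) (p :: ('v,'k::comm_ring_1) mpoly)"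
proof -
  interpret s: comm_ring_hom "subst_vars \<sigma>" by (rule comm_ring_hom_subst_vars)
  show ?thesis
    by (simp add: subst_vars_def[of \<tau>] subst_vars_def[of "\<lambda>v. subst_vars \<sigma> (\<tau> v)"]
        s.hom_sum s.hom_mult s.hom_prod s.hom_power)
qed

lemma subst_vars_id [simp]: "subst_vars Var p = p"
  unfolding subst_vars_def monom_subst_def[symmetric] Monom_eq_prod_Var[symmetric]
  by (rule mpoly_eq_sum_Monom[symmetric])

subsection \<open>Ideals of polynomial rings\<close>

lemma carrier_mpoly_ring: "carrier (mpoly_ring V) = {p. keys p \<subseteq> monomials V}"
  and mult_mpoly_ring [simp]: "x \<otimes>\<^bsub>mpoly_ring V\<^esub> y = x * y"
  and add_mpoly_ring [simp]: "x \<oplus>\<^bsub>mpoly_ring V\<^esub> y = x + y"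
  and zero_mpoly_ring [simp]: "\<zero>\<^bsub>mpoly_ring V\<^esub> = 0"
  and one_mpoly_ring [simp]: "\<one>\<^bsub>mpoly_ring V\<^esub> = 1"
  by (simp_all add: mpoly_ring_def)

lemma monomials_zero [simp]: "0 \<in> monomials V"
  and monomials_single [simp]: "Poly_Mapping.single v k \<in> monomials V \<longleftrightarrow> v \<in> V \<or> k = 0"
  by (auto simp: monomials_def)

lemma keys_plus_nat: "keys (m + n) = keys m \<union> keys (n :: 'v monomial)"
  by (auto simp: in_keys_iff lookup_add)

lemma monomials_plus [simp]: "m + n \<in> monomials V \<longleftrightarrow> m \<in> monomials V \<and> n \<in> monomials V"
  by (auto simp: monomials_def keys_plus_nat)

lemma
  fixes p q :: "('v,'k::comm_ring_1) mpoly"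
  shows zero_carrier: "0 \<in> carrier (mpoly_ring V :: ('v,'k) mpoly ring)"
    and one_carrier: "1 \<in> carrier (mpoly_ring V :: ('v,'k) mpoly ring)"
    and Const_carrier: "(Const c :: ('v,'k) mpoly) \<in> carrier (mpoly_ring V)"
    and Monom_carrier: "m \<in> monomials V \<Longrightarrow> (Monom m :: ('v,'k) mpoly) \<in> carrier (mpoly_ring V)"
    and Var_carrier: "v \<in> V \<Longrightarrow> (Var v :: ('v,'k) mpoly) \<in> carrier (mpoly_ring V)"
    and add_carrier: "p \<in> carrier (mpoly_ring V) \<Longrightarrow> q \<in> carrier (mpoly_ring V) \<Longrightarrow> p + q \<in> carrier (mpoly_ring V)"
    and mult_carrier: "p \<in> carrier (mpoly_ring V) \<Longrightarrow> q \<in> carrier (mpoly_ring V) \<Longrightarrow> p * q \<in> carrier (mpoly_ring V)"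
proof -
  interpret cring "mpoly_ring V :: ('v,'k) mpoly ring" by (rule cring_mpoly_ring)
  show "0 \<in> carrier (mpoly_ring V :: ('v,'k) mpoly ring)" "1 \<in> carrier (mpoly_ring V :: ('v,'k) mpoly ring)"
    using zero_closed one_closed by simp_all
  show "p \<in> carrier (mpoly_ring V) \<Longrightarrow> q \<in> carrier (mpoly_ring V) \<Longrightarrow> p + q \<in> carrier (mpoly_ring V)"
    "p \<in> carrier (mpoly_ring V) \<Longrightarrow> q \<in> carrier (mpoly_ring V) \<Longrightarrow> p * q \<in> carrier (mpoly_ring V)"
    using a_closed m_closed by simp_all
qed (auto simp: carrier_mpoly_ring Const_def Var_def)

lemma uminus_carrier: "p \<in> carrier (mpoly_ring V) \<Longrightarrow> - p \<in> carrier (mpoly_ring V)"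
  by (simp add: carrier_mpoly_ring)

lemma diff_carrier: "p \<in> carrier (mpoly_ring V) \<Longrightarrow> q \<in> carrier (mpoly_ring V) \<Longrightarrow> p - q \<in> carrier (mpoly_ring V)"
  using add_carrier[of p V "- q"] uminus_carrier[of q V] by simp

lemma power_carrier: "p \<in> carrier (mpoly_ring V) \<Longrightarrow> p ^ k \<in> carrier (mpoly_ring V)"
  by (induction k) (auto intro: mult_carrier one_carrier)

lemma sum_carrier: "(\<And>i. i \<in> A \<Longrightarrow> f i \<in> carrier (mpoly_ring V)) \<Longrightarrow> sum f A \<in> carrier (mpoly_ring V)"
  by (induction A rule: infinite_finite_induct) (auto intro: add_carrier zero_carrier)

lemma prod_carrier: "(\<And>i. i \<in> A \<Longrightarrow> f i \<in> carrier (mpoly_ring V)) \<Longrightarrow> prod f A \<in> carrier (mpoly_ring V)"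
  by (induction A rule: infinite_finite_induct) (auto intro: mult_carrier one_carrier)

lemma subst_vars_carrier:
  assumes "p \<in> carrier (mpoly_ring V)" "\<And>v. v \<in> V \<Longrightarrow> \<sigma> v \<in> carrier (mpoly_ring W)"
  shows "subst_vars \<sigma> p \<in> carrier (mpoly_ring W)"
  unfolding subst_vars_def using assms(1)
  by (intro sum_carrier mult_carrier Const_carrier prod_carrier power_carrier assms(2))
     (auto simp: carrier_mpoly_ring monomials_def)

lemma mpoly_idealI:
  fixes K :: "('v,'k::comm_ring_1) mpoly set"
  assumes "K \<subseteq> carrier (mpoly_ring V)" "0 \<in> K" "\<And>p q. p \<in> K \<Longrightarrow> q \<in> K \<Longrightarrow> p + q \<in> K"
    and mult: "\<And>p q. p \<in> K \<Longrightarrow> q \<in> carrier (mpoly_ring V) \<Longrightarrow> q * p \<in> K"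
  shows "ideal K (mpoly_ring V)"
proof -
  let ?R = "mpoly_ring V :: ('v,'k) mpoly ring"
  interpret cring ?R by (rule cring_mpoly_ring)
  have inv: "\<ominus>\<^bsub>?R\<^esub> p = - p" if "p \<in> carrier ?R" for p
    using minus_equality[of "- p" p] that uminus_carrier[OF that] by simp
  have "- p \<in> K" if "p \<in> K" for p
    using mult[OF that, of "- 1"] by (simp add: uminus_carrier one_carrier)
  then have "subgroup K (add_monoid ?R)"
    by (intro add.subgroupI) (use assms inv in auto)
  then show ?thesis
    by (rule idealI[OF ring_axioms]) (use mult in \<open>auto simp: mult.commute\<close>)
qed

context
  fixes K :: "('v,'k::comm_ring_1) mpoly set" and V
  assumes K: "ideal K (mpoly_ring V)"
begin

interpretation ideal K "mpoly_ring V" by (rule K)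

lemma ideal_carrier: "p \<in> K \<Longrightarrow> p \<in> carrier (mpoly_ring V)"
  by (rule Icarr)

lemma ideal_zero: "0 \<in> K"
  using additive_subgroup.zero_closed[OF additive_subgroup_axioms] by simp

lemma ideal_add: "p \<in> K \<Longrightarrow> q \<in> K \<Longrightarrow> p + q \<in> K"
  using additive_subgroup.a_closed[OF additive_subgroup_axioms] by simp

lemma ideal_mult: "p \<in> K \<Longrightarrow> q \<in> carrier (mpoly_ring V) \<Longrightarrow> q * p \<in> K"
  using I_l_closed by simp

lemma ideal_mult_right: "p \<in> K \<Longrightarrow> q \<in> carrier (mpoly_ring V) \<Longrightarrow> p * q \<in> K"
  using I_r_closed by simp

lemma ideal_uminus: "p \<in> K \<Longrightarrow> - p \<in> K"
  using ideal_mult[of p "- 1"] by (simp add: uminus_carrier one_carrier)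

lemma ideal_diff: "p \<in> K \<Longrightarrow> q \<in> K \<Longrightarrow> p - q \<in> K"
  using ideal_add[of p "- q"] by (simp add: ideal_uminus)

lemma ideal_sum: "(\<And>i. i \<in> A \<Longrightarrow> f i \<in> K) \<Longrightarrow> sum f A \<in> K"
  by (induction A rule: infinite_finite_induct) (auto intro: ideal_add ideal_zero)

lemma genideal_subset: "S \<subseteq> K \<Longrightarrow> genideal (mpoly_ring V) S \<subseteq> K"
  by (rule genideal_minimal[OF K])

end

lemma ideal_genideal:
  "S \<subseteq> carrier (mpoly_ring V) \<Longrightarrow> ideal (genideal (mpoly_ring V) S) (mpoly_ring V)"
  using ring.genideal_ideal cring.axioms(1)[OF cring_mpoly_ring] by blast

lemma genideal_self: "S \<subseteq> carrier (mpoly_ring V) \<Longrightarrow> S \<subseteq> genideal (mpoly_ring V) S"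
  using ring.genideal_self cring.axioms(1)[OF cring_mpoly_ring] by blast

lemma genideal_mono:
  "S \<subseteq> T \<Longrightarrow> T \<subseteq> carrier (mpoly_ring V) \<Longrightarrow> genideal (mpoly_ring V) S \<subseteq> genideal (mpoly_ring V) T"
  by (rule genideal_subset[OF ideal_genideal]) (use genideal_self[of T V] in auto)

lemma ideal_vimage:
  assumes "ideal K (mpoly_ring W)" "\<And>v. v \<in> V \<Longrightarrow> \<sigma> v \<in> carrier (mpoly_ring W)"
  shows "ideal {p \<in> carrier (mpoly_ring V). subst_vars \<sigma> p \<in> K} (mpoly_ring V)"
proof -
  interpret comm_ring_hom "subst_vars \<sigma>" by (rule comm_ring_hom_subst_vars)
  show ?thesis
    by (rule mpoly_idealI) (auto simp: hom_add hom_mult intro!: zero_carrier add_carrier mult_carrier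
        ideal_zero[OF assms(1)] ideal_add[OF assms(1)] ideal_mult[OF assms(1)] subst_vars_carrier assms(2))
qed

lemma subst_vars_genideal:
  assumes "ideal K (mpoly_ring W)" "\<And>v. v \<in> V \<Longrightarrow> \<sigma> v \<in> carrier (mpoly_ring W)"
    and "S \<subseteq> carrier (mpoly_ring V)" "\<And>s. s \<in> S \<Longrightarrow> subst_vars \<sigma> s \<in> K"
    and "p \<in> genideal (mpoly_ring V) S"
  shows "subst_vars \<sigma> p \<in> K"
  using genideal_subset[OF ideal_vimage[OF assms(1), of V \<sigma>], of S] assms by auto

text \<open>Congruences modulo \<open>K\<close> pass to products by a b - a' b' = a (b - b') + b' (a
  - a'), hence to powers, monomials and polynomials. Needed to exchange x for y + z modulo the
  linear generators of a join.\<close>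

lemma subst_vars_diff_in_ideal:
  assumes K: "ideal K (mpoly_ring W)"
    and c: "\<And>v. v \<in> V \<Longrightarrow> \<sigma> v \<in> carrier (mpoly_ring W)" "\<And>v. v \<in> V \<Longrightarrow> \<tau> v \<in> carrier (mpoly_ring W)"
    and K': "\<And>v. v \<in> V \<Longrightarrow> \<sigma> v - \<tau> v \<in> K"
    and p: "p \<in> carrier (mpoly_ring V)"
  shows "subst_vars \<sigma> p - subst_vars \<tau> p \<in> K"
proof -
  have mult: "a * b - a' * b' \<in> K" if "a - a' \<in> K" "b - b' \<in> K" "a \<in> carrier (mpoly_ring W)"
    "b' \<in> carrier (mpoly_ring W)" for a a' b b'
  proof -
    have "a * b - a' * b' = a * (b - b') + b' * (a - a')" by (simp add: algebra_simps)
    then show ?thesis using that by (auto intro!: ideal_add[OF K] ideal_mult[OF K])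
  qed
  have pow: "\<sigma> v ^ k - \<tau> v ^ k \<in> K" if "v \<in> V" for v k
    by (induction k) (auto intro!: ideal_zero[OF K] mult K' c power_carrier that)
  have prod: "(\<Prod>v\<in>A. \<sigma> v ^ lookup m v) - (\<Prod>v\<in>A. \<tau> v ^ lookup m v) \<in> K" if "A \<subseteq> V" for A m
    using that by (induction A rule: infinite_finite_induct)
      (auto intro!: ideal_zero[OF K] mult pow prod_carrier power_carrier c)
  have "(\<Sum>m\<in>keys p. Const (lookup p m) * ((\<Prod>v\<in>keys m. \<sigma> v ^ lookup m v) - (\<Prod>v\<in>keys m. \<tau> v ^ lookup m v))) \<in> K"
    using p by (intro ideal_sum[OF K] ideal_mult[OF K] prod Const_carrier) (auto simp: carrier_mpoly_ring monomials_def)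
  then show ?thesis
    by (simp add: subst_vars_def sum_subtractf algebra_simps)
qed

subsection \<open>Monomial ideals\<close>

text \<open>Upward closed conditions on exponents describe monomial ideals. A predicate in place of
  generators also fits the disjunction of support conditions in
  \<open>join_separated_ideal_subset\<close>.\<close>

lemma ideal_of_monomials:
  assumes "\<And>m k. P m \<Longrightarrow> P (m + k)"
  shows "ideal {p \<in> carrier (mpoly_ring V :: ('v,'k::comm_ring_1) mpoly ring). \<forall>n\<in>keys p. P n} (mpoly_ring V)"
    (is "ideal ?K _")
proof (rule mpoly_idealI)
  fix p q assume "p \<in> ?K" "q \<in> ?K"
  then show "p + q \<in> ?K" using Poly_Mapping.keys_add[of p q] by (auto intro: add_carrier)
next
  fix p q :: "('v,'k) mpoly" assume *: "p \<in> ?K" "q \<in> carrier (mpoly_ring V)"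
  have "P (a + n)" if "n \<in> keys p" for a n
    using that * assms by (auto simp: add.commute[of a])
  then show "q * p \<in> ?K" using * Poly_Mapping.keys_mult[of q p]
    by (fastforce intro: mult_carrier)
qed (auto simp: zero_carrier)

text \<open>Divisibility of monomials, in the additive notation of exponent vectors.\<close>

definition madds :: "'v monomial \<Rightarrow> 'v monomial \<Rightarrow> bool" where
  "madds m n \<longleftrightarrow> (\<exists>k. n = m + k)"

lemma madds_iff: "madds m n \<longleftrightarrow> (\<forall>v. lookup m v \<le> lookup n v)"
proof
  assume *: "\<forall>v. lookup m v \<le> lookup n v"
  have "n = m + (n - m)" by (rule poly_mapping_eqI) (use * in \<open>simp add: lookup_add lookup_minus\<close>)
  then show "madds m n" unfolding madds_def by blast
qed (auto simp: madds_def lookup_add)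

text \<open>The termwise condition itself defines an ideal containing the generators; conversely,
  every term that satisfies it is a multiple of a generator.\<close>

lemma Monom_genideal_iff:
  fixes p :: "('v,'k::comm_ring_1) mpoly"
  assumes S: "S \<subseteq> monomials V"
  shows "p \<in> genideal (mpoly_ring V) (Monom ` S)
    \<longleftrightarrow> p \<in> carrier (mpoly_ring V) \<and> (\<forall>n\<in>keys p. \<exists>m\<in>S. madds m n)" (is "?L \<longleftrightarrow> ?R")
proof
  have c: "Monom ` S \<subseteq> carrier (mpoly_ring V :: ('v,'k) mpoly ring)"
    using S by (auto intro!: Monom_carrier)
  note I = ideal_genideal[OF c]
  let ?K = "{p \<in> carrier (mpoly_ring V :: ('v,'k) mpoly ring). \<forall>n\<in>keys p. \<exists>m\<in>S. madds m n}"
  have "ideal ?K (mpoly_ring V)"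
    by (rule ideal_of_monomials) (metis add.assoc madds_def)
  moreover have "Monom ` S \<subseteq> ?K" using c by (auto simp: madds_def intro!: exI[of _ 0])
  ultimately show "?L \<Longrightarrow> ?R" using genideal_subset by blast
  assume R: ?R
  have "Const (lookup p n) * Monom n \<in> genideal (mpoly_ring V) (Monom ` S)" if n: "n \<in> keys p" for n
  proof -
    from R n obtain m k where m: "m \<in> S" "n = m + k" by (auto simp: madds_def)
    have k: "k \<in> monomials V" using R n m by (auto simp: carrier_mpoly_ring)
    have "Monom k * Monom m \<in> genideal (mpoly_ring V) (Monom ` S :: ('v,'k) mpoly set)"
      by (rule ideal_mult[OF I]) (use genideal_self[OF c] m k in \<open>auto intro: Monom_carrier\<close>)
    then show ?thesis
      by (intro ideal_mult[OF I]) (auto simp: Monom_times m add.commute intro: Const_carrier)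
  qed
  then show ?L by (subst mpoly_eq_sum_Monom) (rule ideal_sum[OF I])
qed

subsection \<open>Joins\<close>

abbreviation (input) "XYZ V \<equiv> Xv ` V \<union> Yv ` V \<union> Zv ` V"

definition join_gens :: "'v set \<Rightarrow> ('v,'k::comm_ring_1) mpoly set \<Rightarrow> ('v,'k) mpoly set \<Rightarrow> ('v xyz,'k) mpoly set" where
  "join_gens V I J = subst_vars (\<lambda>v. Var (Yv v)) ` I \<union> subst_vars (\<lambda>v. Var (Zv v)) ` J \<union>
             {Var (Xv v) - Var (Yv v) - Var (Zv v) |v. v \<in> V}"

lemma join_ideal_alt: "join_ideal V I J = {p \<in> carrier (mpoly_ring V).
   subst_vars (\<lambda>v. Var (Xv v)) p \<in> genideal (mpoly_ring (XYZ V)) (join_gens V I J)}"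
  by (simp add: join_ideal_def join_gens_def)

lemma join_gens_carrier:
  assumes "I \<subseteq> carrier (mpoly_ring V)" "J \<subseteq> carrier (mpoly_ring V)"
  shows "join_gens V I J \<subseteq> carrier (mpoly_ring (XYZ V))"
  using assms by (auto simp: join_gens_def intro!: diff_carrier Var_carrier subst_vars_carrier)

lemma ideal_join_ideal:
  assumes "I \<subseteq> carrier (mpoly_ring V)" "J \<subseteq> carrier (mpoly_ring V)"
  shows "ideal (join_ideal V I J) (mpoly_ring V)"
  unfolding join_ideal_alt
  by (rule ideal_vimage[OF ideal_genideal[OF join_gens_carrier[OF assms]]]) (auto intro: Var_carrier)

lemma join_ideal_mono:
  assumes "I \<subseteq> I'" "J \<subseteq> J'" "I' \<subseteq> carrier (mpoly_ring V)" "J' \<subseteq> carrier (mpoly_ring V)"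
  shows "join_ideal V I J \<subseteq> join_ideal V I' J'"
proof -
  have "join_gens V I J \<subseteq> join_gens V I' J'" using assms(1,2) by (auto simp: join_gens_def)
  from genideal_mono[OF this join_gens_carrier[OF assms(3,4)]] show ?thesis
    unfolding join_ideal_alt by blast
qed

text \<open>Universal property of the join: the map \<open>\<rho>\<close> with x =
  \<open>\<sigma>\<close> + \<open>\<tau>\<close>, y = \<open>\<sigma>\<close>, z =
  \<open>\<tau>\<close> sends the generators from \<open>I\<close> and \<open>J\<close> into
  \<open>K\<close> and the linear ones to zero.\<close>

lemma subst_vars_join_ideal:
  assumes I: "I \<subseteq> carrier (mpoly_ring V)" and J: "J \<subseteq> carrier (mpoly_ring V)"
    and K: "ideal K (mpoly_ring W)"
    and c: "\<And>v. v \<in> V \<Longrightarrow> \<sigma> v \<in> carrier (mpoly_ring W)" "\<And>v. v \<in> V \<Longrightarrow> \<tau> v \<in> carrier (mpoly_ring W)"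
    and IK: "\<And>f. f \<in> I \<Longrightarrow> subst_vars \<sigma> f \<in> K" and JK: "\<And>f. f \<in> J \<Longrightarrow> subst_vars \<tau> f \<in> K"
    and p: "p \<in> join_ideal V I J"
  shows "subst_vars (\<lambda>v. \<sigma> v + \<tau> v) p \<in> K"
proof -
  define \<rho> where "\<rho> = case_xyz (\<lambda>v. \<sigma> v + \<tau> v) \<sigma> \<tau>"
  interpret r: comm_ring_hom "subst_vars \<rho>" by (rule comm_ring_hom_subst_vars)
  have "subst_vars \<rho> (subst_vars (\<lambda>v. Var (Xv v)) p) \<in> K"
  proof (rule subst_vars_genideal[OF K _ join_gens_carrier[OF I J]])
    show "\<rho> v \<in> carrier (mpoly_ring W)" if "v \<in> XYZ V" for v
      using that by (auto simp: \<rho>_def intro!: add_carrier c)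
    show "subst_vars (\<lambda>v. Var (Xv v)) p \<in> genideal (mpoly_ring (XYZ V)) (join_gens V I J)"
      using p by (simp add: join_ideal_alt)
    show "subst_vars \<rho> s \<in> K" if "s \<in> join_gens V I J" for s
      using that IK JK ideal_zero[OF K]
      by (auto simp: join_gens_def subst_vars_subst_vars \<rho>_def r.hom_minus[unfolded \<rho>_def])
  qed
  then show ?thesis by (simp add: subst_vars_subst_vars \<rho>_def)
qed

text \<open>Modulo the linear generators x is congruent to y + z, so membership can be tested in y
  and z alone.\<close>

lemma join_idealI:
  assumes I: "I \<subseteq> carrier (mpoly_ring V)" and J: "J \<subseteq> carrier (mpoly_ring V)"
    and p: "p \<in> carrier (mpoly_ring V)"
    and "subst_vars (\<lambda>v. Var (Yv v) + Var (Zv v)) p \<in> genideal (mpoly_ring (XYZ V)) (join_gens V I J)"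
  shows "p \<in> join_ideal V I J"
proof -
  note K = ideal_genideal[OF join_gens_carrier[OF I J]]
  have X: "Var (Xv v) - (Var (Yv v) + Var (Zv v)) \<in> genideal (mpoly_ring (XYZ V)) (join_gens V I J)"
    if "v \<in> V" for v
    using that genideal_self[OF join_gens_carrier[OF I J]]
    by (auto simp: join_gens_def diff_diff_eq)
  have "subst_vars (\<lambda>v. Var (Xv v)) p - subst_vars (\<lambda>v. Var (Yv v) + Var (Zv v)) p
      \<in> genideal (mpoly_ring (XYZ V)) (join_gens V I J)"
    by (rule subst_vars_diff_in_ideal[OF K _ _ _ p])
       (auto intro!: Var_carrier add_carrier X)
  from ideal_add[OF K this assms(4)] p show ?thesis by (simp add: join_ideal_alt)
qed

lemma secant_ideal_1 [simp]: "secant_ideal V I (Suc 0) = I"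
  by (simp add: secant_ideal_def)

lemma secant_ideal_Suc: "r \<ge> 1 \<Longrightarrow> secant_ideal V I (Suc r) = join_ideal V (secant_ideal V I r) I"
  by (cases r) (simp_all add: secant_ideal_def)

lemma ideal_secant_ideal:
  assumes "ideal I (mpoly_ring V)" "r \<ge> 1"
  shows "ideal (secant_ideal V I r) (mpoly_ring V)"
  using assms(2)
  by (induction r rule: dec_induct)
     (auto simp: assms(1) secant_ideal_Suc intro!: ideal_join_ideal dest: ideal_carrier[OF assms(1)] ideal_carrier)

subsection \<open>Leading monomials\<close>

text \<open>A relation that fails for the zero polynomial. It keeps the definite description behind
  \<open>lead_exp\<close> out of the arguments.\<close>

definition is_lead :: "'v monomial rel \<Rightarrow> ('v,'k::comm_ring_1) mpoly \<Rightarrow> 'v monomial \<Rightarrow> bool" where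
  "is_lead ord p m \<longleftrightarrow> m \<in> keys p \<and> (\<forall>n\<in>keys p. (n, m) \<in> ord)"

definition lead_exp :: "'v monomial rel \<Rightarrow> ('v,'k::comm_ring_1) mpoly \<Rightarrow> 'v monomial" where
  "lead_exp ord p = (THE m. is_lead ord p m)"

lemma lead_mono_eq: "lead_mono ord p = Monom (lead_exp ord p)"
  by (simp add: lead_mono_def lead_exp_def is_lead_def)

context
  fixes V :: "'v set" and ord
  assumes ord: "term_order V ord"
begin

lemma ord_refl: "m \<in> monomials V \<Longrightarrow> (m, m) \<in> ord"
  using ord by (auto simp: term_order_def linear_order_on_def partial_order_on_def preorder_on_def refl_on_def)

lemma ord_trans: "(m, n) \<in> ord \<Longrightarrow> (n, k) \<in> ord \<Longrightarrow> (m, k) \<in> ord"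
  using ord by (auto simp: term_order_def linear_order_on_def partial_order_on_def preorder_on_def dest: transD)

lemma ord_antisym: "(m, n) \<in> ord \<Longrightarrow> (n, m) \<in> ord \<Longrightarrow> m = n"
  using ord by (auto simp: term_order_def linear_order_on_def partial_order_on_def dest: antisymD)

lemma ord_total: "m \<in> monomials V \<Longrightarrow> n \<in> monomials V \<Longrightarrow> (m, n) \<in> ord \<or> (n, m) \<in> ord"
  using ord ord_refl by (cases "m = n") (auto simp: term_order_def linear_order_on_def total_on_def)

lemma ord_zero: "m \<in> monomials V \<Longrightarrow> (0, m) \<in> ord"
  using ord by (auto simp: term_order_def)

lemma ord_plus: "(m, n) \<in> ord \<Longrightarrow> k \<in> monomials V \<Longrightarrow> (m + k, n + k) \<in> ord"
  using ord by (auto simp: term_order_def)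

lemma finite_has_max: "finite A \<Longrightarrow> A \<noteq> {} \<Longrightarrow> A \<subseteq> monomials V \<Longrightarrow> \<exists>m\<in>A. \<forall>n\<in>A. (n, m) \<in> ord"
proof (induction A rule: finite_ne_induct)
  case (insert x A)
  then obtain m where m: "m \<in> A" "\<forall>n\<in>A. (n, m) \<in> ord" by auto
  have "(x, m) \<in> ord \<or> (m, x) \<in> ord" by (rule ord_total) (use insert m in auto)
  then show ?case
  proof
    assume "(m, x) \<in> ord"
    then show ?thesis using m insert.prems by (intro bexI[of _ x]) (auto intro: ord_trans ord_refl)
  qed (use m in auto)
qed (auto intro: ord_refl)

lemma is_lead_unique: "is_lead ord p m \<Longrightarrow> is_lead ord p n \<Longrightarrow> m = n"
  by (auto simp: is_lead_def intro: ord_antisym)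

lemma lead_exp_eqI: "is_lead ord p m \<Longrightarrow> lead_exp ord p = m"
  unfolding lead_exp_def by (rule the_equality) (auto intro: is_lead_unique)

lemma is_lead_lead_exp:
  assumes "p \<in> carrier (mpoly_ring V)" "p \<noteq> 0"
  shows "is_lead ord p (lead_exp ord p)"
proof -
  have "\<exists>m. is_lead ord p m"
    using finite_has_max[of "keys p"] assms by (auto simp: is_lead_def carrier_mpoly_ring)
  then show ?thesis using lead_exp_eqI by metis
qed

end

lemma lead_exp_monomials:
  assumes "term_order V ord" "p \<in> carrier (mpoly_ring V)" "p \<noteq> 0"
  shows "lead_exp ord p \<in> monomials V"
  using is_lead_lead_exp[OF assms] assms(2) by (auto simp: is_lead_def carrier_mpoly_ring)

lemma initial_ideal_alt:
  "initial_ideal V ord I = genideal (mpoly_ring V) (Monom ` (lead_exp ord ` (I - {0})))"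
  unfolding initial_ideal_def lead_mono_eq by (rule arg_cong[where f="genideal _"]) auto

lemma lead_exps_monomials:
  assumes "term_order V ord" "I \<subseteq> carrier (mpoly_ring V)"
  shows "lead_exp ord ` (I - {0}) \<subseteq> monomials V"
  using assms lead_exp_monomials by blast

lemma initial_ideal_carrier:
  assumes "term_order V ord" "I \<subseteq> carrier (mpoly_ring V)"
  shows "Monom ` lead_exp ord ` (I - {0}) \<subseteq> carrier (mpoly_ring V)"
  using lead_exps_monomials[OF assms] by (auto intro: Monom_carrier)

lemma ideal_initial_ideal:
  assumes "term_order V ord" "I \<subseteq> carrier (mpoly_ring V)"
  shows "ideal (initial_ideal V ord I) (mpoly_ring V)"
  unfolding initial_ideal_alt by (rule ideal_genideal[OF initial_ideal_carrier[OF assms]])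

lemma Monom_initial_ideal_iff:
  assumes "term_order V ord" "I \<subseteq> carrier (mpoly_ring V)" "m \<in> monomials V"
  shows "Monom m \<in> initial_ideal V ord I \<longleftrightarrow> (\<exists>f\<in>I - {0}. madds (lead_exp ord f) m)"
  unfolding initial_ideal_alt Monom_genideal_iff[OF lead_exps_monomials[OF assms(1,2)]]
  using assms(3) by (auto intro: Monom_carrier)

subsection \<open>Initial ideals of joins\<close>

abbreviation (input) pairing :: "('m \<Rightarrow> 'k) \<Rightarrow> ('m \<Rightarrow>\<^sub>0 'k::comm_ring_1) \<Rightarrow> 'k" where
  "pairing \<equiv> lin (\<lambda>c. c)"

lemmas pairing_add = lin_add[OF comm_ring_hom_id]
lemmas pairing_sum = lin_sum[OF comm_ring_hom_id]
lemmas pairing_times = lin_times_left[OF comm_ring_hom_id]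

lemma pairing_single [simp]: "pairing \<tau> (Poly_Mapping.single m c) = c * \<tau> m"
  by (simp add: lin_single)

lemma pairing_Const_times: "pairing \<tau> (Const c * p) = c * pairing \<tau> p"
  by (subst pairing_times) (simp add: Const_def lin_def)

lemma pairing_Monom_times: "pairing \<tau> (Monom m * p) = pairing (\<lambda>n. \<tau> (m + n)) (p :: ('v,'k::comm_ring_1) mpoly)"
  by (subst pairing_times) (simp add: Monom_def)

text \<open>A basis of \<open>U\<close> stays independent after adding \<open>a\<close>, so a linear
  map with value 1 at \<open>a\<close> and 0 on that basis exists. It is returned through its values
  on monomials, so that two such functionals can be multiplied into one on polynomials in y and
  z.\<close>

lemma exists_linear_functional:
  fixes U :: "('v,'k::field) mpoly set"
  assumes "0 \<in> U" "\<And>p q. p \<in> U \<Longrightarrow> q \<in> U \<Longrightarrow> p + q \<in> U" "\<And>c p. p \<in> U \<Longrightarrow> Const c * p \<in> U"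
    and a: "a \<notin> U"
  shows "\<exists>\<alpha>. pairing \<alpha> a = 1 \<and> (\<forall>p\<in>U. pairing \<alpha> p = 0)"
proof -
  let ?s = "\<lambda>c (p :: ('v,'k) mpoly). Const c * p"
  interpret C: comm_ring_hom "Const :: 'k \<Rightarrow> ('v,'k) mpoly" by (rule comm_ring_hom_Const)
  interpret vector_space_pair ?s "(*) :: 'k \<Rightarrow> 'k \<Rightarrow> 'k"
    by unfold_locales (auto simp: algebra_simps C.hom_add C.hom_mult)
  have "vs1.subspace U" using assms by (auto simp: vs1.subspace_def)
  obtain B where B: "B \<subseteq> U" "vs1.independent B" "U \<subseteq> vs1.span B"
    by (rule vs1.maximal_independent_subset)
  have "vs1.span B = U"
    using B \<open>vs1.subspace U\<close> vs1.span_minimal by blast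
  with a have "vs1.independent (insert a B)"
    using B vs1.independent_insertI by metis
  then obtain g where g: "Vector_Spaces.linear ?s (*) g" "\<forall>x\<in>insert a B. g x = (if x = a then 1 else 0)"
    using linear_independent_extend[of "insert a B" "\<lambda>x. if x = a then 1 else 0"] by blast
  interpret g: Vector_Spaces.linear ?s "(*)" g by (rule g(1))
  have "g x = 0" if "x \<in> B" for x using g(2) that B(1) a by auto
  then have gU: "g x = 0" if "x \<in> U" for x
    using that B(3) linear_eq_0_on_span[OF g(1)] by blast
  have "g (\<Sum>m\<in>keys p. Const (lookup p m) * Monom m) = pairing (\<lambda>m. g (Monom m)) p" for p
    by (simp add: g.sum g.scale lin_def)
  then have gp: "pairing (\<lambda>m. g (Monom m)) p = g p" for p
    unfolding mpoly_eq_sum_Monom[symmetric] by (rule sym)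
  show ?thesis
    by (rule exI[of _ "\<lambda>m. g (Monom m)"]) (simp add: gp gU g(2))
qed

text \<open>The monomial of \<open>a\<close> is not in \<open>I\<close> plus the span
  \<open>L\<close> of strictly smaller monomials: if it were f + h, then f would be an element of
  \<open>I\<close> with leading exponent \<open>a\<close>. A functional separating it from this sum
  is the required one.\<close>

lemma exists_functional_standard:
  fixes I :: "('v,'k::field) mpoly set"
  assumes ord: "term_order V ord" and I: "ideal I (mpoly_ring V)"
    and a: "a \<in> monomials V" "a \<notin> lead_exp ord ` (I - {0})"
  shows "\<exists>\<alpha>. \<alpha> a = 1 \<and> (\<forall>c. (c, a) \<in> ord \<and> c \<noteq> a \<longrightarrow> \<alpha> c = 0) \<and> (\<forall>f\<in>I. pairing \<alpha> f = 0)"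
proof -
  define L where "L = {h :: ('v,'k) mpoly. \<forall>c\<in>keys h. (c, a) \<in> ord \<and> c \<noteq> a}"
  define U where "U = {f + h |f h. f \<in> I \<and> h \<in> L}"
  have L0: "0 \<in> L" by (auto simp: L_def)
  have Ladd: "p + q \<in> L" if "p \<in> L" "q \<in> L" for p q
    using that Poly_Mapping.keys_add[of p q] by (auto simp: L_def)
  have Lsc: "Const c * p \<in> L" if "p \<in> L" for c p
    using that Poly_Mapping.keys_mult[of "Const c" p] by (fastforce simp: L_def Const_def split: if_splits)
  have "\<exists>\<alpha>. pairing \<alpha> (Monom a :: ('v,'k) mpoly) = 1 \<and> (\<forall>p\<in>U. pairing \<alpha> p = 0)"
  proof (rule exists_linear_functional)
    show "0 \<in> U" using L0 ideal_zero[OF I] by (force simp: U_def)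
    show "p + q \<in> U" if pq: "p \<in> U" "q \<in> U" for p q
    proof -
      from pq obtain f h f' h' where *: "p = f + h" "q = f' + h'" "f \<in> I" "f' \<in> I" "h \<in> L" "h' \<in> L"
        unfolding U_def by auto
      have "p + q = (f + f') + (h + h')" by (simp add: *)
      then show ?thesis using * Ladd ideal_add[OF I] unfolding U_def by blast
    qed
    show "Const c * p \<in> U" if p: "p \<in> U" for c p
    proof -
      from p obtain f h where *: "p = f + h" "f \<in> I" "h \<in> L" unfolding U_def by auto
      have "Const c * p = Const c * f + Const c * h" by (simp add: * algebra_simps)
      then show ?thesis using * Lsc ideal_mult[OF I] Const_carrier unfolding U_def by blast
    qed
    show "Monom a \<notin> U"
    proof
      assume "Monom a \<in> U"
      then obtain f h where fh: "Monom a = f + h" "f \<in> I" "h \<in> L" unfolding U_def by auto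
      have f: "f = Monom a - h" using fh by simp
      have lh: "lookup h a = 0" using fh(3) by (auto simp: L_def in_keys_iff)
      have "lookup f a = 1" unfolding f by (simp add: lookup_minus lh Monom_def)
      then have "a \<in> keys f" by (simp add: in_keys_iff)
      moreover have "(c, a) \<in> ord" if "c \<in> keys f" for c
        using that keys_diff[of "Monom a" h] fh(3) ord_refl[OF ord a(1)]
        unfolding f L_def by auto
      ultimately have "is_lead ord f a" by (simp add: is_lead_def)
      moreover from this have "f \<noteq> 0" by (auto simp: is_lead_def)
      ultimately show False using a(2) fh(2) lead_exp_eqI[OF ord] by force
    qed
  qed
  then obtain \<alpha> where \<alpha>: "pairing \<alpha> (Monom a) = (1::'k)" "\<forall>p\<in>U. pairing \<alpha> p = 0" by blast
  have "f \<in> U" if "f \<in> I" for f using that L0 by (force simp: U_def)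
  moreover have "Monom c \<in> U" if "(c, a) \<in> ord" "c \<noteq> a" for c
    using that ideal_zero[OF I] by (force simp: U_def L_def)
  ultimately show ?thesis using \<alpha>
    by (intro exI[of _ \<alpha>]) (force simp: Monom_def)
qed

section \<open>Splitting exponents into their y and z parts\<close>

definition rename :: "('v \<Rightarrow> 'w) \<Rightarrow> 'v monomial \<Rightarrow> 'w monomial" where
  "rename f m = (\<Sum>v\<in>keys m. Poly_Mapping.single (f v) (lookup m v))"

lemma Var_power: "Var v ^ k = Monom (Poly_Mapping.single v k)"
  by (simp add: Monom_eq_prod_Var)

lemma monom_subst_Var: "monom_subst (\<lambda>v. Var (f v)) m = Monom (rename f m)"
  by (simp add: monom_subst_def rename_def Monom_sum Var_power)

lemma lookup_rename: "inj f \<Longrightarrow> lookup (rename f m) (f v) = lookup m v"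
  by (simp add: rename_def lookup_sum lookup_single when_def inj_eq in_keys_iff)

lemma lookup_rename_notin: "w \<notin> range f \<Longrightarrow> lookup (rename f m) w = 0"
  by (auto simp: rename_def lookup_sum lookup_single when_def)

abbreviation "ypart \<equiv> Poly_Mapping.map_key Yv"
abbreviation "zpart \<equiv> Poly_Mapping.map_key Zv"

lemma inj_xyz [simp]: "inj Xv" "inj Yv" "inj Zv"
  by (auto intro: injI)

lemma lookup_ypart [simp]: "lookup (ypart n) v = lookup n (Yv v)"
  and lookup_zpart [simp]: "lookup (zpart n) v = lookup n (Zv v)"
  by (simp_all add: map_key.rep_eq)

lemma part_rename [simp]: "ypart (rename Yv m) = m" "zpart (rename Zv m) = m"
  "ypart (rename Zv m) = 0" "zpart (rename Yv m) = 0"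
  by (auto intro!: poly_mapping_eqI simp: lookup_rename lookup_rename_notin image_iff)

lemma part_plus: "ypart (m + n) = ypart m + ypart n" "zpart (m + n) = zpart m + zpart n"
  by (auto intro!: poly_mapping_eqI simp: lookup_add)

lemma rename_parts:
  assumes "n \<in> monomials (Yv ` V \<union> Zv ` V)"
  shows "rename Yv (ypart n) + rename Zv (zpart n) = n"
proof (rule poly_mapping_eqI)
  fix w show "lookup (rename Yv (ypart n) + rename Zv (zpart n)) w = lookup n w"
  proof (cases w)
    case (Xv v)
    then have "lookup n w = 0" using assms by (auto simp: monomials_def in_keys_iff subset_eq)
    then show ?thesis using Xv by (simp add: lookup_add lookup_rename_notin image_iff)
  qed (auto simp: lookup_add lookup_rename lookup_rename_notin image_iff)
qed

lemma part_monomials: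
  assumes "n \<in> monomials (Yv ` V \<union> Zv ` V)"
  shows "ypart n \<in> monomials V" "zpart n \<in> monomials V"
  using assms by (auto simp: monomials_def keys_map_key)

text \<open>Give y_v and z_v the multidegree of x_v. Each factor y_v + z_v is then homogeneous, and
  the sets \<open>H m\<close> multiply like graded pieces.\<close>

lemma keys_monom_subst_sum:
  assumes "n \<in> keys (monom_subst (\<lambda>v. Var (Yv v) + Var (Zv v)) m :: ('v xyz,'k::comm_ring_1) mpoly)"
    and m: "m \<in> monomials V"
  shows "n \<in> monomials (Yv ` V \<union> Zv ` V)" "ypart n + zpart n = m"
proof -
  define H where "H m = {q :: ('v xyz,'k) mpoly. \<forall>n\<in>keys q. n \<in> monomials (Yv ` V \<union> Zv ` V) \<and> ypart n + zpart n = m}" for m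
  have mult: "p * q \<in> H (m + m')" if "p \<in> H m" "q \<in> H m'" for p q m m'
    using that Poly_Mapping.keys_mult[of p q] unfolding H_def by (fastforce simp: part_plus ac_simps)
  have one: "1 \<in> H 0" by (auto simp: H_def intro!: poly_mapping_eqI simp: lookup_add)
  have var: "Var (Yv v) + Var (Zv v) \<in> H (Poly_Mapping.single v 1)" if "v \<in> V" for v
    using that Poly_Mapping.keys_add[of "Var (Yv v)" "Var (Zv v) :: ('v xyz,'k) mpoly"]
    by (auto simp: H_def Var_def intro!: poly_mapping_eqI simp: lookup_add lookup_single when_def)
  have pow: "(Var (Yv v) + Var (Zv v)) ^ k \<in> H (Poly_Mapping.single v k)" if "v \<in> V" for v k
  proof (induction k)
    case (Suc k)
    show ?case using mult[OF var[OF that] Suc] by (simp flip: single_add)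
  qed (use one in simp)
  have "(\<Prod>v\<in>A. (Var (Yv v) + Var (Zv v)) ^ lookup m v) \<in> H (\<Sum>v\<in>A. Poly_Mapping.single v (lookup m v))"
    if "A \<subseteq> V" for A
    using that by (induction A rule: infinite_finite_induct) (auto intro!: mult pow one)
  from this[of "keys m"] have "monom_subst (\<lambda>v. Var (Yv v) + Var (Zv v)) m \<in> H m"
    using m by (simp add: monom_subst_def poly_mapping_sum_single monomials_def)
  then show "n \<in> monomials (Yv ` V \<union> Zv ` V)" "ypart n + zpart n = m"
    using assms by (auto simp: H_def)
qed

text \<open>Closed under multiplication because shifting \<open>\<alpha>\<close> and
  \<open>\<beta>\<close> by a monomial yields functionals that again vanish on \<open>I\<close> and
  \<open>J\<close>. This is why all pairs are quantified inside the set and not fixed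
  outside.\<close>

lemma ideal_annihilator:
  fixes I J :: "('v,'k::field) mpoly set"
  assumes I: "ideal I (mpoly_ring V)" and J: "ideal J (mpoly_ring V)"
  shows "ideal {q \<in> carrier (mpoly_ring (Yv ` V \<union> Zv ` V)).
     \<forall>\<alpha> \<beta>. (\<forall>f\<in>I. pairing \<alpha> f = 0) \<and> (\<forall>f\<in>J. pairing \<beta> f = 0) \<longrightarrow>
       pairing (\<lambda>n. \<alpha> (ypart n) * \<beta> (zpart n)) q = 0} (mpoly_ring (Yv ` V \<union> Zv ` V))"
    (is "ideal ?K (mpoly_ring ?W)")
proof (rule mpoly_idealI)
  have shift: "pairing (\<lambda>n. \<alpha> (m + n)) f = 0" if "f \<in> K" "m \<in> monomials V" "\<forall>f\<in>K. pairing \<alpha> f = 0"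
    "ideal K (mpoly_ring V)" for m \<alpha> f and K :: "('v,'k) mpoly set"
    using that ideal_mult[OF that(4), of f "Monom m"] by (auto simp flip: pairing_Monom_times intro: Monom_carrier)
  fix p q :: "('v xyz,'k) mpoly" assume p: "p \<in> ?K" and q: "q \<in> carrier (mpoly_ring ?W)"
  have "pairing (\<lambda>n. \<alpha> (ypart n) * \<beta> (zpart n)) (q * p) = 0"
    if "\<forall>f\<in>I. pairing \<alpha> f = 0" "\<forall>f\<in>J. pairing \<beta> f = 0" for \<alpha> \<beta>
  proof -
    have "pairing (\<lambda>n. \<alpha> (ypart m + ypart n) * \<beta> (zpart m + zpart n)) p = 0" if m: "m \<in> keys q" for m
    proof -
      have "m \<in> monomials ?W" using m q by (auto simp: carrier_mpoly_ring)
      note pm = part_monomials[OF this]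
      have "\<forall>f\<in>I. pairing (\<lambda>n. \<alpha> (ypart m + n)) f = 0" "\<forall>f\<in>J. pairing (\<lambda>n. \<beta> (zpart m + n)) f = 0"
        using shift pm I J \<open>\<forall>f\<in>I. pairing \<alpha> f = 0\<close> \<open>\<forall>f\<in>J. pairing \<beta> f = 0\<close> by blast+
      then show ?thesis using p by blast
    qed
    then show ?thesis by (simp add: pairing_times part_plus)
  qed
  then show "q * p \<in> ?K" using p q by (auto intro: mult_carrier)
qed (auto intro: zero_carrier add_carrier simp: pairing_add)

text \<open>A polynomial in y alone has trivial z part, so the second functional contributes only
  its value at the exponent 0; hence \<open>I\<close> in y and \<open>J\<close> in z lie in the
  annihilator.\<close>

lemma subst_Var_in_annihilator:
  fixes f :: "('v,'k::field) mpoly"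
  shows "pairing (\<lambda>n. \<alpha> (ypart n) * \<beta> (zpart n)) (subst_vars (\<lambda>v. Var (Yv v)) f) = pairing \<alpha> f * \<beta> 0"
    and "pairing (\<lambda>n. \<alpha> (ypart n) * \<beta> (zpart n)) (subst_vars (\<lambda>v. Var (Zv v)) f) = \<alpha> 0 * pairing \<beta> f"
  unfolding subst_vars_eq_lin lin_def[of Const] monom_subst_Var pairing_sum Const_times_Monom
  by (simp_all add: lin_def[of _ _ f] sum_distrib_left sum_distrib_right mult_ac)

text \<open>
  If \<open>x\<^sup>m\<close> leads \<open>p \<in> I * J\<close> and \<open>y\<^sup>a z\<^sup>b\<close> with \<open>a + b = m\<close> occurs in \<open>(y + z)\<^sup>m\<close> although \<open>a\<close> and \<open>b\<close>
  are standard, take functionals \<open>\<alpha>\<close> and \<open>\<beta>\<close> that vanish on \<open>I\<close> and \<open>J\<close>, are \<open>1\<close> at \<open>a\<close> and \<open>b\<close>, and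
  \<open>0\<close> at all smaller monomials.  Then \<open>y\<^sup>a z\<^sup>b\<close> is the only term of \<open>p(y + z)\<close> that
  \<open>\<alpha> \<otimes> \<beta>\<close> does not kill, but \<open>\<alpha> \<otimes> \<beta>\<close> vanishes on \<open>p(y + z)\<close>.  Binomial coefficients
  are never computed, so the characteristic does not matter.
\<close>

theorem initial_ideal_join_subset:
  fixes I J :: "('v,'k::field) mpoly set"
  assumes ord: "term_order V ord" and I: "ideal I (mpoly_ring V)" and J: "ideal J (mpoly_ring V)"
  shows "initial_ideal V ord (join_ideal V I J)
       \<subseteq> join_ideal V (initial_ideal V ord I) (initial_ideal V ord J)"
proof -
  have Ic: "I \<subseteq> carrier (mpoly_ring V)" and Jc: "J \<subseteq> carrier (mpoly_ring V)"
    using ideal_carrier I J by blast+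
  note inI = ideal_initial_ideal[OF ord Ic] and inJ = ideal_initial_ideal[OF ord Jc]
  have inIc: "initial_ideal V ord I \<subseteq> carrier (mpoly_ring V)"
    and inJc: "initial_ideal V ord J \<subseteq> carrier (mpoly_ring V)"
    using ideal_carrier inI inJ by blast+
  let ?G = "genideal (mpoly_ring (XYZ V)) (join_gens V (initial_ideal V ord I) (initial_ideal V ord J))"
  let ?E = "\<lambda>m. monom_subst (\<lambda>v. Var (Yv v) + Var (Zv v)) m :: ('v xyz,'k) mpoly"
  let ?W = "Yv ` V \<union> Zv ` V"
  note G = ideal_genideal[OF join_gens_carrier[OF inIc inJc]]
  note Gs = genideal_self[OF join_gens_carrier[OF inIc inJc]]
  note Jo = ideal_join_ideal[OF inIc inJc]
  have "Monom (lead_exp ord p) \<in> join_ideal V (initial_ideal V ord I) (initial_ideal V ord J)"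
    if p: "p \<in> join_ideal V I J" "p \<noteq> 0" for p
  proof -
    define m where "m = lead_exp ord p"
    have pc: "p \<in> carrier (mpoly_ring V)" using p by (simp add: join_ideal_def)
    have m: "is_lead ord p m" unfolding m_def by (rule is_lead_lead_exp[OF ord pc p(2)])
    then have mV: "m \<in> monomials V" using pc by (auto simp: is_lead_def carrier_mpoly_ring)
    have "Monom n \<in> ?G" if n: "n \<in> keys (?E m)" for n
    proof -
      note n' = keys_monom_subst_sum[OF n mV]
      note pn = part_monomials[OF n'(1)]
      have split: "Monom n = Monom (rename Yv (ypart n)) * Monom (rename Zv (zpart n))"
        by (simp add: Monom_times rename_parts[OF n'(1)])
      have rc: "Monom (rename Yv (ypart n)) \<in> carrier (mpoly_ring (XYZ V))"
        "Monom (rename Zv (zpart n)) \<in> carrier (mpoly_ring (XYZ V))"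
        using subst_vars_carrier[OF Monom_carrier[OF pn(1)], of "\<lambda>v. Var (Yv v)" "XYZ V"]
          subst_vars_carrier[OF Monom_carrier[OF pn(2)], of "\<lambda>v. Var (Zv v)" "XYZ V"]
        by (simp_all add: monom_subst_Var Var_carrier)
      consider "Monom (ypart n) \<in> initial_ideal V ord I" | "Monom (zpart n) \<in> initial_ideal V ord J"
      proof (rule ccontr)
        assume "\<not> thesis"
        then have "Monom (ypart n) \<notin> initial_ideal V ord I" "Monom (zpart n) \<notin> initial_ideal V ord J"
          using that by auto
        then have std: "ypart n \<notin> lead_exp ord ` (I - {0})" "zpart n \<notin> lead_exp ord ` (J - {0})"
          using genideal_self[OF initial_ideal_carrier[OF ord Ic]] genideal_self[OF initial_ideal_carrier[OF ord Jc]]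
          unfolding initial_ideal_alt by blast+
        obtain \<alpha> where \<alpha>: "\<alpha> (ypart n) = 1" "\<And>c. (c, ypart n) \<in> ord \<Longrightarrow> c \<noteq> ypart n \<Longrightarrow> \<alpha> c = 0"
          "\<forall>f\<in>I. pairing \<alpha> f = 0"
          using exists_functional_standard[OF ord I pn(1) std(1)] by blast
        obtain \<beta> where \<beta>: "\<beta> (zpart n) = 1" "\<And>c. (c, zpart n) \<in> ord \<Longrightarrow> c \<noteq> zpart n \<Longrightarrow> \<beta> c = 0"
          "\<forall>f\<in>J. pairing \<beta> f = 0"
          using exists_functional_standard[OF ord J pn(2) std(2)] by blast
        define T where "T = (\<lambda>n. \<alpha> (ypart n) * \<beta> (zpart n))"
        have "subst_vars (\<lambda>v. Var (Yv v) + Var (Zv v)) p \<in> {q \<in> carrier (mpoly_ring ?W).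
           \<forall>\<alpha> \<beta>. (\<forall>f\<in>I. pairing \<alpha> f = 0) \<and> (\<forall>f\<in>J. pairing \<beta> f = 0) \<longrightarrow>
           pairing (\<lambda>n. \<alpha> (ypart n) * \<beta> (zpart n)) q = 0}"
          by (rule subst_vars_join_ideal[OF Ic Jc ideal_annihilator[OF I J] _ _ _ _ p(1)])
             (use Ic Jc in \<open>auto simp: subst_Var_in_annihilator intro!: Var_carrier subst_vars_carrier\<close>)
        then have "pairing T (subst_vars (\<lambda>v. Var (Yv v) + Var (Zv v)) p) = 0"
          using \<alpha>(3) \<beta>(3) by (auto simp: T_def)
        then have 0: "(\<Sum>m'\<in>keys p. lookup p m' * pairing T (?E m')) = 0"
          by (simp add: subst_vars_eq_lin lin_def[of Const] pairing_sum pairing_Const_times)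
        \<comment> \<open>The y and z parts of \<open>n'\<close> cannot lie below those of
          \<open>n\<close>, since \<open>\<alpha>\<close> and \<open>\<beta>\<close> vanish there;
          yet their sum \<open>m'\<close> is at most \<open>m\<close>. Compatibility with addition
          forces equality in both parts.\<close>
        have T: "n' = n \<and> m' = m"
          if m': "m' \<in> keys p" and n'': "n' \<in> keys (?E m')" and nz: "T n' \<noteq> 0" for m' n'
        proof -
          have m'V: "m' \<in> monomials V" using m' pc by (auto simp: carrier_mpoly_ring)
          note k = keys_monom_subst_sum[OF n'' m'V]
          note pn' = part_monomials[OF k(1)]
          have "(ypart n, ypart n') \<in> ord" "(zpart n, zpart n') \<in> ord"
            using nz \<alpha>(2)[of "ypart n'"] \<beta>(2)[of "zpart n'"] ord_total[OF ord] ord_refl[OF ord] pn pn'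
            unfolding T_def by (metis mult_zero_left mult_zero_right)+
          then have 1: "(zpart n + ypart n, zpart n' + ypart n) \<in> ord" "(ypart n + zpart n', ypart n' + zpart n') \<in> ord"
            using ord_plus[OF ord] pn pn' by blast+
          have 2: "(ypart n' + zpart n', ypart n + zpart n) \<in> ord"
            using m' m k(2) n'(2) by (auto simp: is_lead_def)
          have "ypart n + zpart n = ypart n + zpart n'"
            using 1 2 ord_antisym[OF ord] ord_trans[OF ord] by (metis add.commute)
          then have z: "zpart n' = zpart n" by simp
          then have "ypart n' = ypart n" using 1 2 ord_antisym[OF ord] by (metis add.commute add_left_imp_eq)
          with z k n' rename_parts[OF k(1)] rename_parts[OF n'(1)] show ?thesis by metis
        qed
        have PT: "pairing T (?E m') = (if m' = m then lookup (?E m) n else 0)" if "m' \<in> keys p" for m'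
        proof -
          have Tn: "T n = 1" by (simp add: T_def \<alpha>(1) \<beta>(1))
          have "lookup (?E m') n' * T n' = (if n' = n \<and> m' = m then lookup (?E m) n else 0)"
            if n': "n' \<in> keys (?E m')" for n'
          proof (cases "n' = n \<and> m' = m")
            case False
            then have "T n' = 0" using T[OF \<open>m' \<in> keys p\<close> n'] by blast
            then show ?thesis using False by auto
          qed (simp add: Tn)
          then have "pairing T (?E m') = (\<Sum>n'\<in>keys (?E m'). if n' = n \<and> m' = m then lookup (?E m) n else 0)"
            unfolding lin_def by (intro sum.cong refl)
          then show ?thesis using n by (simp cong: conj_cong)
        qed
        \<comment> \<open>Only one term survives, so a product of two nonzero coefficients is zero
          in a field.\<close>
        have "(\<Sum>m'\<in>keys p. if m' = m then lookup p m * lookup (?E m) n else 0) =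
            (\<Sum>m'\<in>keys p. lookup p m' * pairing T (?E m'))"
          by (rule sum.cong) (simp_all add: PT)
        also note 0
        finally have "lookup p m * lookup (?E m) n = 0" using m by (simp add: is_lead_def)
        then show False using m n by (auto simp: is_lead_def in_keys_iff)
      qed
      then show ?thesis
      proof cases
        case 1
        then have "Monom (rename Yv (ypart n)) \<in> ?G"
          by (intro Gs[THEN subsetD]) (auto simp: join_gens_def monom_subst_Var intro!: image_eqI[of _ _ "Monom (ypart n)"])
        then show ?thesis unfolding split by (rule ideal_mult_right[OF G _ rc(2)])
      next
        case 2
        then have "Monom (rename Zv (zpart n)) \<in> ?G"
          by (intro Gs[THEN subsetD]) (auto simp: join_gens_def monom_subst_Var intro!: image_eqI[of _ _ "Monom (zpart n)"])
        then show ?thesis unfolding split by (rule ideal_mult[OF G _ rc(1)])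
      qed
    qed
    \<comment> \<open>Every term occurring in the expansion of (y + z)^m now lies in the join
      generators' ideal, hence so does their sum.\<close>
    then have "?E m \<in> ?G"
      by (subst mpoly_eq_sum_Monom) (intro ideal_sum[OF G] ideal_mult[OF G] Const_carrier)
    then show ?thesis unfolding m_def[symmetric]
      by (intro join_idealI[OF inIc inJc Monom_carrier[OF mV]]) simp
  qed
  then show ?thesis
    unfolding initial_ideal_alt[of V ord "join_ideal V I J"]
    by (intro genideal_subset[OF Jo]) auto
qed

subsection \<open>Secants of the initial ideal\<close>

definition separated :: "nat set \<Rightarrow> bool" where
  "separated S \<longleftrightarrow> (\<forall>i\<in>S. \<forall>j\<in>S. i < j \<longrightarrow> i + 2 \<le> j)"

definition squarefree_monomial :: "'v set \<Rightarrow> 'v monomial" where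
  "squarefree_monomial S = (\<Sum>s\<in>S. Poly_Mapping.single s 1)"

definition separated_sets :: "nat \<Rightarrow> nat \<Rightarrow> nat set set" where
  "separated_sets d r = {S. S \<subseteq> {..d} \<and> card S = r + 1 \<and> separated S}"

definition separated_ideal :: "nat \<Rightarrow> nat \<Rightarrow> (nat, 'k::comm_ring_1) mpoly set" where
  "separated_ideal d r = genideal (mpoly_ring {..d}) (Monom ` squarefree_monomial ` separated_sets d r)"

lemma lookup_squarefree_monomial:
  "finite S \<Longrightarrow> lookup (squarefree_monomial S) v = (if v \<in> S then 1 else 0)"
  by (simp add: squarefree_monomial_def lookup_sum lookup_single when_def)

lemma keys_squarefree_monomial: "finite S \<Longrightarrow> keys (squarefree_monomial S) = S"
  by (auto simp: in_keys_iff lookup_squarefree_monomial split: if_splits)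

lemma madds_squarefree_monomial: "finite S \<Longrightarrow> madds (squarefree_monomial S) m \<longleftrightarrow> S \<subseteq> keys m"
  by (auto simp: madds_iff lookup_squarefree_monomial in_keys_iff Suc_le_eq)

lemma separated_sets_finite: "S \<in> separated_sets d r \<Longrightarrow> finite S"
  by (auto simp: separated_sets_def intro: finite_subset)

lemma squarefree_monomials_separated: "squarefree_monomial ` separated_sets d r \<subseteq> monomials {..d}"
  by (auto simp: monomials_def keys_squarefree_monomial separated_sets_finite)
     (auto simp: separated_sets_def)

lemma separated_ideal_carrier:
  "Monom ` squarefree_monomial ` separated_sets d r \<subseteq> carrier (mpoly_ring {..d})"
  using squarefree_monomials_separated by (blast intro: Monom_carrier)

lemma ideal_separated_ideal: "ideal (separated_ideal d r) (mpoly_ring {..d})"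
  unfolding separated_ideal_def by (rule ideal_genideal[OF separated_ideal_carrier])

lemma separated_ideal_iff:
  "p \<in> separated_ideal d r \<longleftrightarrow>
     p \<in> carrier (mpoly_ring {..d}) \<and> (\<forall>n\<in>keys p. \<exists>S\<subseteq>keys n. card S = r + 1 \<and> separated S)"
  unfolding separated_ideal_def Monom_genideal_iff[OF squarefree_monomials_separated]
proof (intro conj_cong refl ball_cong)
  fix n assume "p \<in> carrier (mpoly_ring {..d})" "n \<in> keys p"
  then have "keys n \<subseteq> {..d}" by (auto simp: carrier_mpoly_ring monomials_def)
  then show "(\<exists>m\<in>squarefree_monomial ` separated_sets d r. madds m n)
     \<longleftrightarrow> (\<exists>S\<subseteq>keys n. card S = r + 1 \<and> separated S)"
    by (auto simp: bex_simps madds_squarefree_monomial separated_sets_finite)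
       (auto simp: separated_sets_def madds_squarefree_monomial finite_subset[OF _ finite_keys])
qed

text \<open>Setting the variables outside \<open>A\<close> to zero fixes the generators supported in
  \<open>A\<close> and kills all others, so only the former have to be checked.\<close>

lemma subst_restrict_separated:
  fixes f :: "(nat, 'k::comm_ring_1) mpoly"
  assumes K: "ideal K (mpoly_ring {..d})" and f: "f \<in> separated_ideal d r"
    and sub: "\<And>S. S \<in> separated_sets d r \<Longrightarrow> S \<subseteq> A \<Longrightarrow> Monom (squarefree_monomial S) \<in> K"
  shows "subst_vars (\<lambda>v. if v \<in> A then Var v else 0) f \<in> K"
proof (rule subst_vars_genideal[OF K _ separated_ideal_carrier])
  show "f \<in> Idl\<^bsub>mpoly_ring {..d}\<^esub> Monom ` squarefree_monomial ` separated_sets d r"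
    using f by (simp add: separated_ideal_def)
  show "(if v \<in> A then Var v else 0 :: (nat, 'k) mpoly) \<in> carrier (mpoly_ring {..d})" if "v \<in> {..d}" for v
    using that by (auto intro: Var_carrier zero_carrier)
  fix s :: "(nat,'k) mpoly" assume "s \<in> Monom ` squarefree_monomial ` separated_sets d r"
  then obtain S where S: "S \<in> separated_sets d r" "s = Monom (squarefree_monomial S)" by auto
  note fin = separated_sets_finite[OF S(1)]
  have eq: "subst_vars (\<lambda>v. if v \<in> A then Var v else 0 :: (nat,'k) mpoly) s = (\<Prod>v\<in>S. if v \<in> A then Var v else 0 :: (nat,'k) mpoly)"
    by (simp add: S(2) monom_subst_def keys_squarefree_monomial fin lookup_squarefree_monomial)
  show "subst_vars (\<lambda>v. if v \<in> A then Var v else 0) s \<in> K"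
  proof (cases "S \<subseteq> A")
    case True
    then have "(\<Prod>v\<in>S. if v \<in> A then Var v else 0) = (\<Prod>v\<in>S. Var v :: (nat,'k) mpoly)"
      by (intro prod.cong) auto
    also have "\<dots> = Monom (squarefree_monomial S)"
      by (simp add: squarefree_monomial_def Monom_sum Var_def)
    finally show ?thesis using eq sub[OF S(1) True] by simp
  next
    case False
    then have "(\<Prod>v\<in>S. if v \<in> A then Var v else 0 :: (nat,'k) mpoly) = 0"
      by (intro prod_zero fin) auto
    then show ?thesis using eq ideal_zero[OF K] by simp
  qed
qed

text \<open>
  Let \<open>i\<close> be the smallest variable of a monomial of \<open>p\<close>.  Setting \<open>y\<^sub>v = x\<^sub>v, z\<^sub>v = 0\<close> for
  \<open>v \<ge> i + 2\<close> and \<open>y\<^sub>v = 0, z\<^sub>v = x\<^sub>v\<close> otherwise leaves \<open>p\<close> unchanged.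
\<close>

lemma join_separated_ideal_subset:
  "join_ideal {..d} (separated_ideal d r) (separated_ideal d 1)
     \<subseteq> (separated_ideal d (r + 1) :: (nat, 'k::comm_ring_1) mpoly set)"
proof
  fix p :: "(nat, 'k) mpoly"
  assume p: "p \<in> join_ideal {..d} (separated_ideal d r) (separated_ideal d 1)"
  have I: "separated_ideal d r \<subseteq> (carrier (mpoly_ring {..d}) :: (nat, 'k) mpoly set)" for r
    using ideal_carrier[OF ideal_separated_ideal] by blast
  have "\<exists>S\<subseteq>keys n. card S = r + 1 + 1 \<and> separated S" if n: "n \<in> keys p" for n
  proof -
    define i where "i = Min (keys n)"
    define A where "A = {v. i + 2 \<le> v}"
    \<comment> \<open>A sum of two monomial ideals in complementary sets of variables. It is chosen
      for the one exponent \<open>n\<close> at hand, and in the end only \<open>n\<close> is tested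
      against it.\<close>
    define P where "P n \<longleftrightarrow> (\<exists>S\<subseteq>keys n \<inter> A. card S = r + 1 \<and> separated S) \<or>
      (\<exists>S\<subseteq>keys n - A. card S = 2 \<and> separated S)" for n :: "nat monomial"
    let ?K = "{p \<in> carrier (mpoly_ring {..d} :: (nat, 'k) mpoly ring). \<forall>n\<in>keys p. P n}"
    have K: "ideal ?K (mpoly_ring {..d})"
    proof (rule ideal_of_monomials)
      fix m k assume "P m"
      moreover have "keys m \<inter> A \<subseteq> keys (m + k) \<inter> A" "keys m - A \<subseteq> keys (m + k) - A"
        by (auto simp: keys_plus_nat)
      ultimately show "P (m + k)" unfolding P_def by (meson order_trans)
    qed
    have sq: "Monom (squarefree_monomial S) \<in> ?K"
      if S: "S \<in> separated_sets d r'" and "(r' = r \<and> S \<subseteq> A) \<or> (r' = 1 \<and> S \<subseteq> - A)" for S r'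
    proof -
      have "squarefree_monomial S \<in> monomials {..d}" using squarefree_monomials_separated S by blast
      moreover have "P (squarefree_monomial S)"
        unfolding P_def keys_squarefree_monomial[OF separated_sets_finite[OF S]]
        using that by (auto simp: separated_sets_def)
      ultimately show ?thesis by (simp add: Monom_carrier)
    qed
    have "subst_vars (\<lambda>v. (if v \<in> A then Var v else 0) + (if v \<in> - A then Var v else 0)) p \<in> ?K"
    proof (rule subst_vars_join_ideal[OF I I K _ _ _ _ p])
      show "subst_vars (\<lambda>v. if v \<in> A then Var v else 0) f \<in> ?K" if "f \<in> separated_ideal d r" for f
        by (rule subst_restrict_separated[OF K that]) (rule sq, blast+)
      show "subst_vars (\<lambda>v. if v \<in> - A then Var v else 0) f \<in> ?K" if "f \<in> separated_ideal d 1" for f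
        by (rule subst_restrict_separated[OF K that]) (rule sq, blast+)
    qed (auto intro: Var_carrier zero_carrier)
    moreover have "(\<lambda>v. (if v \<in> A then Var v else 0) + (if v \<in> - A then Var v else 0)) = (Var :: _ \<Rightarrow> (nat,'k) mpoly)"
      by auto
    ultimately have "P n" using n by simp
    then consider S where "S \<subseteq> keys n \<inter> A" "card S = r + 1" "separated S"
      | S where "S \<subseteq> keys n - A" "card S = 2" "separated S"
      by (auto simp: P_def)
    then show ?thesis
    proof cases
      case 1
      then have "keys n \<noteq> {}" by auto
      then have "i \<in> keys n" unfolding i_def by (intro Min_in) auto
      moreover have "i \<notin> S" using 1(1) by (auto simp: A_def)
      moreover have "finite S" using 1 by (intro card_ge_0_finite) simp
      moreover have "separated (insert i S)" using 1 by (auto simp: separated_def A_def)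
      ultimately show ?thesis using 1 by (intro exI[of _ "insert i S"]) auto
    next
      case 2
      \<comment> \<open>No variable of \<open>n\<close> is below \<open>i\<close>, so those outside
        \<open>A\<close> are among \<open>i\<close> and \<open>i + 1\<close>, too close for a
        separated pair.\<close>
      obtain a b where ab: "a \<in> S" "b \<in> S" "a < b" using 2(2)
        by (auto simp: card_2_iff) (metis insertCI linorder_neqE_nat)
      then have "a + 2 \<le> b" using 2(3) by (auto simp: separated_def)
      moreover have "i \<le> a" unfolding i_def by (rule Min_le) (use ab 2 in auto)
      ultimately show ?thesis using 2(1) ab by (auto simp: A_def)
    qed
  qed
  then show "p \<in> separated_ideal d (r + 1)"
    using p by (auto simp: separated_ideal_iff join_ideal_def)
qed

lemma secant_separated_ideal_subset:
  assumes "r \<ge> 1"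
  shows "secant_ideal {..d} (separated_ideal d 1) r \<subseteq> (separated_ideal d r :: (nat, 'k::comm_ring_1) mpoly set)"
  using assms
proof (induction r rule: dec_induct)
  case (step r)
  have "join_ideal {..d} (secant_ideal {..d} (separated_ideal d 1) r) (separated_ideal d 1)
    \<subseteq> join_ideal {..d} (separated_ideal d r) (separated_ideal d 1 :: (nat, 'k) mpoly set)"
    by (rule join_ideal_mono) (use step ideal_carrier[OF ideal_separated_ideal] in auto)
  then show ?case using join_separated_ideal_subset step(1) by (fastforce simp: secant_ideal_Suc)
qed simp

subsection \<open>Leading terms of Hankel minors\<close>

definition hankel_minor :: "nat \<Rightarrow> (nat \<Rightarrow> nat) \<Rightarrow> (nat, 'k::comm_ring_1) mpoly mat" where
  "hankel_minor r c = mat (r + 1) (r + 1) (\<lambda>(a, b). Var (a + c b))"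

text \<open>Column choices as increasing functions, which gives direct access to the
  \<open>b\<close>-th chosen column. Only the values on \<open>{..r}\<close> matter.\<close>

definition hankel_columns :: "nat \<Rightarrow> nat \<Rightarrow> (nat \<Rightarrow> nat) set" where
  "hankel_columns d r = {c. strict_mono_on {..r} c \<and> (\<forall>b\<le>r. c b + r \<le> d)}"

text \<open>Choosing \<open>r + 1\<close> of the \<open>r + 1\<close> rows leaves no freedom, and a
  set of columns corresponds to its increasing enumeration by \<open>pick\<close>. For
  \<open>r > d\<close> both sides are empty.\<close>

lemma square_submatrices_hankel:
  "square_submatrices (r + 1) (hankel d r :: (nat, 'k::comm_ring_1) mpoly mat) = hankel_minor r ` hankel_columns d r"
proof (intro equalityI subsetI)
  fix M :: "(nat, 'k) mpoly mat" assume "M \<in> square_submatrices (r + 1) (hankel d r)"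
  then obtain I J where M: "M = submatrix (hankel d r) I J" "I \<subseteq> {..<r+1}" "J \<subseteq> {..<d + 1 - r}"
    "card I = r + 1" "card J = r + 1"
    by (auto simp: square_submatrices_def hankel_def)
  have I: "I = {..<r+1}" using M by (intro card_subset_eq) auto
  have J: "finite J" using M finite_subset by blast
  have pI: "pick I a = a" if "a < r + 1" for a
    using pick_card_in_set[of a I] that I by (simp add: Collect_conj_eq lessThan_def[symmetric] Int_absorb1)
  have rows: "{i. i < dim_row (hankel d r :: (nat, 'k) mpoly mat) \<and> i \<in> I} = {..<r+1}"
    using I by (auto simp: hankel_def)
  have cols: "{i. i < dim_col (hankel d r :: (nat, 'k) mpoly mat) \<and> i \<in> J} = J"
    using M(3) by (auto simp: hankel_def)
  have pJ: "pick J b \<in> J" if "b < r + 1" for b using pick_in_set_le[of b J] that M by simp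
  have bound: "pick J b < d + 1 - r" if "b < r + 1" for b using pJ[OF that] M(3) by auto
  have "strict_mono_on {..r} (pick J)"
    by (rule strict_mono_onI) (use pick_mono_le[of _ J] M in auto)
  moreover have "pick J b + r \<le> d" if "b \<le> r" for b using bound[of b] that by linarith
  ultimately have "pick J \<in> hankel_columns d r" by (auto simp: hankel_columns_def)
  moreover have "M = hankel_minor r (pick J)"
  proof (rule eq_matI)
    fix a b assume "a < dim_row (hankel_minor r (pick J) :: (nat, 'k) mpoly mat)"
      "b < dim_col (hankel_minor r (pick J) :: (nat, 'k) mpoly mat)"
    then have ab: "a < r + 1" "b < r + 1" by (auto simp: hankel_minor_def)
    then show "M $$ (a, b) = hankel_minor r (pick J) $$ (a, b)"
      using bound[of b] pI[of a]
      by (simp add: M(1) submatrix_def rows cols M(5) hankel_minor_def) (simp add: hankel_def)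
  qed (simp_all add: M(1) submatrix_def rows cols M(5) hankel_minor_def)
  ultimately show "M \<in> hankel_minor r ` hankel_columns d r" by blast
next
  fix M :: "(nat, 'k) mpoly mat" assume "M \<in> hankel_minor r ` hankel_columns d r"
  then obtain c where c: "strict_mono_on {..r} c" "\<And>b. b \<le> r \<Longrightarrow> c b + r \<le> d" "M = hankel_minor r c"
    by (auto simp: hankel_columns_def)
  define J where "J = c ` {..r}"
  have inj: "inj_on c {..r}" using c(1) by (rule strict_mono_on_imp_inj_on)
  have cJ: "card J = r + 1" using inj by (simp add: J_def card_image)
  have pJ: "pick J b = c b" if b: "b \<le> r" for b
  proof -
    have "{a \<in> J. a < c b} = c ` {..<b}"
      using c(1) b by (auto simp: J_def strict_mono_on_def)
         (metis imageI lessThan_iff linorder_neqE_nat order_less_asym less_irrefl_nat)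
    moreover have "card (c ` {..<b}) = b"
      by (subst card_image) (use b in \<open>auto intro: inj_on_subset[OF inj]\<close>)
    ultimately show ?thesis using pick_card_in_set[of "c b" J] b by (auto simp: J_def)
  qed
  have Jd: "J \<subseteq> {..<d + 1 - r}" using c(2) by (fastforce simp: J_def)
  have pI: "pick {..<r+1} a = a" if "a < r + 1" for a
    using pick_card_in_set[of a "{..<r+1}"] that by (simp add: Collect_conj_eq lessThan_def[symmetric] Int_absorb1)
  have rows: "{i. i < dim_row (hankel d r :: (nat, 'k) mpoly mat) \<and> i < Suc r} = {..<Suc r}"
    by (auto simp: hankel_def)
  have cols: "{i. i < dim_col (hankel d r :: (nat, 'k) mpoly mat) \<and> i \<in> J} = J"
    using Jd by (auto simp: hankel_def)
  have "M = submatrix (hankel d r) {..<r+1} J"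
  proof (rule eq_matI)
    fix a b assume "a < dim_row (submatrix (hankel d r :: (nat, 'k) mpoly mat) {..<r+1} J)"
      "b < dim_col (submatrix (hankel d r :: (nat, 'k) mpoly mat) {..<r+1} J)"
    then have ab: "a < r + 1" "b < r + 1" by (auto simp: submatrix_def rows cols cJ)
    then show "M $$ (a, b) = submatrix (hankel d r) {..<r+1} J $$ (a, b)"
      using c(2)[of b] pI[of a] pJ[of b]
      by (simp add: c(3) submatrix_def rows cols cJ hankel_minor_def) (simp add: hankel_def)
  qed (simp_all add: c(3) submatrix_def rows cols cJ hankel_minor_def)
  then show "M \<in> square_submatrices (r + 1) (hankel d r)"
    using Jd cJ unfolding square_submatrices_def
    by (intro CollectI exI[of _ "{..<r+1}"] exI[of _ J]) (auto simp: hankel_def)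
qed

lemma minors_hankel: "minors (r + 1) (hankel d r) = (\<lambda>c. det (hankel_minor r c)) ` hankel_columns d r"
  unfolding minors_def square_submatrices_hankel by (rule image_image)

lemma det_mat_carrier:
  assumes "\<And>a b. a < n \<Longrightarrow> b < n \<Longrightarrow> f (a, b) \<in> carrier (mpoly_ring V)"
  shows "det (mat n n f) \<in> carrier (mpoly_ring V)"
proof -
  have "signof p \<in> carrier (mpoly_ring V :: ('a, 'b) mpoly ring)" for p :: "nat \<Rightarrow> nat"
    by (cases "sign p = (1::int)") (auto simp: sign_def one_carrier uminus_carrier)
  then show ?thesis
    unfolding det_def
    by (auto intro!: sum_carrier mult_carrier prod_carrier assms simp: permutes_in_image[of _ "{0..<n}"])
qed

lemma det_hankel_minor_carrier:
  assumes "c \<in> hankel_columns d r"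
  shows "det (hankel_minor r c) \<in> carrier (mpoly_ring {..d})"
  unfolding hankel_minor_def
proof (rule det_mat_carrier, clarify)
  fix a b assume "a < r + 1" "b < r + 1"
  then have "a + c b \<le> d" using assms by (force simp: hankel_columns_def less_Suc_eq_le)
  then show "Var (a + c b) \<in> carrier (mpoly_ring {..d})" by (auto intro: Var_carrier)
qed

lemma minors_hankel_carrier: "minors (r + 1) (hankel d r) \<subseteq> carrier (mpoly_ring {..d})"
  unfolding minors_hankel using det_hankel_minor_carrier by blast

lemma det_mat_2: "det (mat 2 2 f) = f (0, 0) * f (1, 1) - f (0, 1) * (f (1, 0) :: 'a::comm_ring_1)"
proof -
  have "det (mat 2 2 f) = (\<Sum>j<2. mat 2 2 f $$ (0, j) * cofactor (mat 2 2 f) 0 j)"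
    by (rule laplace_expansion_row) auto
  also have "\<dots> = f (0, 0) * cofactor (mat 2 2 f) 0 0 + f (0, 1) * cofactor (mat 2 2 f) 0 1"
    by (simp add: numeral_2_eq_2)
  also have "cofactor (mat 2 2 f) 0 0 = f (1, 1)"
    unfolding cofactor_def by (subst det_single) (auto simp: mat_delete_def)
  also have "cofactor (mat 2 2 f) 0 1 = - f (1, 0)"
    unfolding cofactor_def by (subst det_single) (auto simp: mat_delete_def)
  finally show ?thesis by simp
qed

lemma det_hankel_minor_1:
  "det (hankel_minor 1 c) = Var (c 0) * Var (Suc (c 1)) - Var (c 1) * Var (Suc (c 0))"
  using det_mat_2[of "\<lambda>(a, b). Var (a + c b)"] by (simp add: hankel_minor_def numeral_2_eq_2)

section \<open>The diagonal monomial of a minor\<close>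

definition diag_monomial :: "nat \<Rightarrow> (nat \<Rightarrow> nat) \<Rightarrow> nat monomial" where
  "diag_monomial r c = (\<Sum>i\<in>{0..<r+1}. Poly_Mapping.single (i + c i) 1)"

text \<open>If \<open>p\<close> fixes everything below \<open>i\<close>, the variable with index
  \<open>i + c i\<close> must come from a row \<open>k\<close> with \<open>k >= i\<close> and
  \<open>p k >= i\<close>; both summands of \<open>k + c (p k)\<close> are then minimal, so
  \<open>k = i\<close> and \<open>p k = i\<close>. Hence the diagonal term of the determinant never
  cancels, whatever the characteristic.\<close>

lemma hankel_term_unique:
  fixes c :: "nat \<Rightarrow> nat" and N :: nat
  assumes c: "strict_mono_on {..<N} c" and p: "p permutes {0..<N}"
    and eq: "(\<Sum>i\<in>{0..<N}. Poly_Mapping.single (i + c (p i)) (1::nat)) = (\<Sum>i\<in>{0..<N}. Poly_Mapping.single (i + c i) 1)"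
  shows "p = id"
proof -
  have lt: "c a < c b" if "a < b" "b < N" for a b
    using strict_mono_onD[OF c, of a b] that by auto
  have le: "c a \<le> c b" if "a \<le> b" "b < N" for a b
    using lt that by (metis le_neq_implies_less less_imp_le_nat order_refl)
  have fix_p: "p i = i" if "i < N" for i
    using that
  proof (induction i rule: less_induct)
    case (less i)
    have split: "{0..<N} = {0..<i} \<union> {i..<N}" using less.prems by auto
    have s: "(\<Sum>k\<in>{0..<N}. f k) = (\<Sum>k\<in>{0..<i}. f k) + (\<Sum>k\<in>{i..<N}. f k)" for f :: "nat \<Rightarrow> nat monomial"
      unfolding split by (rule sum.union_disjoint) auto
    have "(\<Sum>k\<in>{0..<i}. Poly_Mapping.single (k + c (p k)) 1) = (\<Sum>k\<in>{0..<i}. Poly_Mapping.single (k + c k) (1::nat))"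
      using less by (intro sum.cong) auto
    with eq have "(\<Sum>k\<in>{i..<N}. Poly_Mapping.single (k + c (p k)) 1) = (\<Sum>k\<in>{i..<N}. Poly_Mapping.single (k + c k) (1::nat))"
      unfolding s by simp
    then have "lookup (\<Sum>k\<in>{i..<N}. Poly_Mapping.single (k + c (p k)) 1) (i + c i) =
        lookup (\<Sum>k\<in>{i..<N}. Poly_Mapping.single (k + c k) (1::nat)) (i + c i)" by simp
    moreover have "lookup (\<Sum>k\<in>{i..<N}. Poly_Mapping.single (k + c k) (1::nat)) (i + c i) \<noteq> 0"
      using less.prems by (auto simp: lookup_sum lookup_single when_def)
    ultimately have "(\<Sum>k\<in>{i..<N}. (1 when k + c (p k) = i + c i)) \<noteq> (0::nat)"
      by (simp add: lookup_sum lookup_single)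
    then obtain k where k: "k \<in> {i..<N}" "k + c (p k) = i + c i"
      by (rule sum.not_neutral_contains_not_neutral) (auto simp: when_def split: if_splits)
    have pk: "p k \<in> {0..<N}" using k permutes_in_image[OF p] by auto
    have "i \<le> p k"
    proof (rule ccontr)
      assume "\<not> i \<le> p k"
      then have "p (p k) = p k" using less by auto
      then have "p k = k" using permutes_inj[OF p] by (auto dest: injD)
      then show False using \<open>\<not> i \<le> p k\<close> k by auto
    qed
    with le[of i "p k"] pk k have "k = i" "c (p k) = c i" by auto
    moreover have "p k = i" using lt[of i "p k"] \<open>i \<le> p k\<close> pk \<open>c (p k) = c i\<close> by (cases "p k = i") auto
    ultimately show ?case by simp
  qed
  show ?thesis
  proof
    fix x show "p x = id x"
      using fix_p[of x] permutes_not_in[OF p, of x] by (cases "x < N") auto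
  qed
qed

lemma lookup_det_hankel_minor:
  assumes "strict_mono_on {..r} c"
  shows "lookup (det (hankel_minor r c)) (diag_monomial r c) = (1 :: 'k::comm_ring_1)"
proof -
  have l: "lookup (signof p * (Monom m) :: (nat, 'k) mpoly) n = (if m = n then signof p else 0)" for p m n
    by (cases "sign p = (1::int)") (auto simp: sign_def Monom_def lookup_single when_def)
  have "det (hankel_minor r c) = (\<Sum>p\<in>{p. p permutes {0..<r+1}}. signof p *
      (\<Prod>i\<in>{0..<r+1}. hankel_minor r c $$ (i, p i) :: (nat, 'k) mpoly))"
    by (rule det_def') (simp add: hankel_minor_def)
  also have "\<dots> = (\<Sum>p\<in>{p. p permutes {0..<r+1}}. signof p * Monom (\<Sum>i\<in>{0..<r+1}. Poly_Mapping.single (i + c (p i)) 1))"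
  proof (intro sum.cong refl arg_cong2[where f="(*)"])
    fix p assume "p \<in> {p. p permutes {0..<r+1}}"
    then have "p i < r + 1" if "i < r + 1" for i using permutes_in_image[of p "{0..<r+1}" i] that by auto
    then show "(\<Prod>i\<in>{0..<r+1}. hankel_minor r c $$ (i, p i) :: (nat, 'k) mpoly) =
       Monom (\<Sum>i\<in>{0..<r+1}. Poly_Mapping.single (i + c (p i)) 1)"
      unfolding Monom_sum by (intro prod.cong) (auto simp: hankel_minor_def Var_def)
  qed
  finally have "lookup (det (hankel_minor r c)) (diag_monomial r c) =
      (\<Sum>p\<in>{p. p permutes {0..<r+1}}. if (\<Sum>i\<in>{0..<r+1}. Poly_Mapping.single (i + c (p i)) 1) = diag_monomial r c
         then signof p else (0::'k))"
    by (simp only: lookup_sum l)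
  also have "\<dots> = (\<Sum>p\<in>{p. p permutes {0..<r+1}}. if p = id then 1 else 0)"
  proof (rule sum.cong[OF refl])
    fix p assume "p \<in> {p. p permutes {0..<r+1}}"
    then have "p = id" if "(\<Sum>i\<in>{0..<r+1}. Poly_Mapping.single (i + c (p i)) 1) = diag_monomial r c"
      using hankel_term_unique[of "r + 1" c p] assms that
      by (auto simp: diag_monomial_def lessThan_Suc_atMost simp del: sum.op_ivl_Suc)
    moreover have "(\<Sum>i\<in>{0..<r+1}. Poly_Mapping.single (i + c (id i)) 1) = diag_monomial r c"
      by (simp add: diag_monomial_def)
    ultimately show "(if (\<Sum>i\<in>{0..<r+1}. Poly_Mapping.single (i + c (p i)) 1) = diag_monomial r c
         then signof p else (0::'k)) = (if p = id then 1 else 0)"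
      by auto
  qed
  finally have "lookup (det (hankel_minor r c)) (diag_monomial r c) =
      (\<Sum>p\<in>{p. p permutes {0..<r+1}}. if p = id then 1 else (0::'k))" .
  then show ?thesis by (simp add: finite_permutations permutes_id)
qed

lemma is_lead_hankel_minor:
  assumes diag: "diagonal_term_order TYPE('k::comm_ring_1) d ord" and r: "r \<ge> 1"
    and c: "c \<in> hankel_columns d r"
  shows "is_lead ord (det (hankel_minor r c) :: (nat, 'k) mpoly) (diag_monomial r c)"
proof -
  have ord: "term_order {..d} ord" using diag by (simp add: diagonal_term_order_def)
  have cm: "strict_mono_on {..r} c" using c by (simp add: hankel_columns_def)
  \<comment> \<open>The existence of \<open>c\<close> forces \<open>2 * r <= d\<close>, so the size
    \<open>min (r + 1) (d + 1 - r)\<close> in the definition of a diagonal order is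
    \<open>r + 1\<close>.\<close>
  have "b \<le> c b" if "b \<le> r" for b using that
  proof (induction b)
    case (Suc b)
    have "c b < c (Suc b)" using cm Suc.prems by (auto simp: strict_mono_on_def)
    then show ?case using Suc by simp
  qed simp
  then have "r \<le> c r" by simp
  then have rd: "2 * r \<le> d" using c by (force simp: hankel_columns_def)
  have "hankel_minor r c \<in> square_submatrices (min (r + 1) (d + 1 - r)) (hankel d r :: (nat, 'k) mpoly mat)"
    using c rd square_submatrices_hankel[of r d] by (auto simp: min_def)
  then have "lead_mono ord (det (hankel_minor r c)) =
      (\<Prod>i<dim_row (hankel_minor r c :: (nat, 'k) mpoly mat). hankel_minor r c $$ (i, i) :: (nat, 'k) mpoly)"
    using diag[unfolded diagonal_term_order_def, THEN conjunct2, rule_format, of r] r rd by simp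
  also have "\<dots> = Monom (diag_monomial r c)"
    unfolding Monom_sum diag_monomial_def lessThan_atLeast0
    by (rule prod.cong) (auto simp: hankel_minor_def Var_def)
  finally have "lead_exp ord (det (hankel_minor r c) :: (nat, 'k) mpoly) = diag_monomial r c"
    by (simp add: lead_mono_eq)
  \<comment> \<open>The hypothesis on \<open>ord\<close> prescribes \<open>lead_mono\<close>, which
    is meaningful only for a nonzero determinant.\<close>
  moreover have "det (hankel_minor r c) \<noteq> (0 :: (nat, 'k) mpoly)"
    using lookup_det_hankel_minor[OF cm, where 'k='k] by auto
  ultimately show ?thesis
    using is_lead_lead_exp[OF ord det_hankel_minor_carrier[OF c]] by metis
qed

subsection \<open>The initial ideal of the rational normal curve\<close>

definition weight :: "('v \<Rightarrow> nat) \<Rightarrow> 'v monomial \<Rightarrow> nat" where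
  "weight h m = (\<Sum>v\<in>keys m. h v * lookup m v)"

lemma weight_superset:
  assumes "finite A" "keys m \<subseteq> A"
  shows "weight h m = (\<Sum>v\<in>A. h v * lookup m v)"
  unfolding weight_def by (rule sum.mono_neutral_left) (use assms in \<open>auto simp: in_keys_iff\<close>)

lemma weight_plus: "weight h (m + n) = weight h m + weight h n"
  using weight_superset[of "keys m \<union> keys n" m h] weight_superset[of "keys m \<union> keys n" n h]
    weight_superset[of "keys m \<union> keys n" "m + n" h]
  by (simp add: keys_plus_nat lookup_add algebra_simps sum.distrib)

lemma weight_single [simp]: "weight h (Poly_Mapping.single v k) = h v * k"
  by (simp add: weight_def)

text \<open>Under the parametrization x_i = s t^i of the rational normal curve, \<open>mdeg\<close>
  and \<open>mwt\<close> are the exponents of s and t in the image of a monomial.\<close>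

abbreviation "mdeg m \<equiv> weight (\<lambda>_. 1) m"
abbreviation "mwt m \<equiv> weight (\<lambda>v. v) m"

lemma hankel_ideal_alt:
  "hankel_ideal d = genideal (mpoly_ring {..d}) ((\<lambda>c. det (hankel_minor 1 c)) ` hankel_columns d 1)"
  by (simp only: hankel_ideal_def one_add_one[symmetric] minors_hankel)

lemma minors_hankel_1_carrier:
  "(\<lambda>c. det (hankel_minor 1 c)) ` hankel_columns d 1 \<subseteq> carrier (mpoly_ring {..d})"
  using det_hankel_minor_carrier by blast

lemma ideal_hankel_ideal: "ideal (hankel_ideal d) (mpoly_ring {..d})"
  unfolding hankel_ideal_alt by (rule ideal_genideal[OF minors_hankel_1_carrier])

lemma Var_times: "Var i * Var j = Monom (Poly_Mapping.single i 1 + Poly_Mapping.single j 1)"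
  by (simp add: Var_def Monom_times)

text \<open>This expresses vanishing on the rational normal curve: with an indicator function for
  \<open>\<phi>\<close>, the coefficients in each bidegree sum to zero. A 2 x 2 minor is a
  difference of two monomials of equal bidegree, and multiplying by a monomial only shifts
  \<open>\<phi>\<close>.\<close>

lemma hankel_ideal_graded:
  assumes "f \<in> (hankel_ideal d :: (nat, 'k::comm_ring_1) mpoly set)"
  shows "pairing (\<lambda>m. \<phi> (mdeg m) (mwt m)) f = 0"
proof -
  let ?K = "{p \<in> carrier (mpoly_ring {..d}) :: (nat, 'k) mpoly set. \<forall>\<phi>. pairing (\<lambda>m. \<phi> (mdeg m) (mwt m)) p = 0}"
  have "ideal ?K (mpoly_ring {..d})"
  proof (rule mpoly_idealI)
    fix p q :: "(nat, 'k) mpoly" assume p: "p \<in> ?K" and q: "q \<in> carrier (mpoly_ring {..d})"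
    have "pairing (\<lambda>n. \<phi> (mdeg m + mdeg n) (mwt m + mwt n)) p = 0" for \<phi> m
      using p[simplified, THEN conjunct2, rule_format, of "\<lambda>a b. \<phi> (mdeg m + a) (mwt m + b)"] by simp
    then show "q * p \<in> ?K" using p q by (auto simp: pairing_times weight_plus intro: mult_carrier)
  qed (auto simp: zero_carrier add_carrier pairing_add)
  moreover have "det (hankel_minor 1 c) \<in> ?K" if "c \<in> hankel_columns d 1" for c
  proof -
    have "pairing (\<lambda>m. \<phi> (mdeg m) (mwt m)) (det (hankel_minor 1 c) :: (nat, 'k) mpoly) = 0" for \<phi>
      by (simp add: det_hankel_minor_1[simplified] Var_times lin_diff[OF comm_ring_hom_id])
         (simp add: Monom_def weight_plus add.commute)
    then show ?thesis using det_hankel_minor_carrier[OF that] by auto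
  qed
  ultimately have "hankel_ideal d \<subseteq> ?K" unfolding hankel_ideal_alt by (intro genideal_subset) auto
  then show ?thesis using assms by blast
qed

text \<open>All variables lie within distance one of the smallest. For \<open>m = 0\<close> the
  minimum is unspecified, but there is no variable to check.\<close>

lemma no_separated_pair:
  assumes "\<not> (\<exists>S\<subseteq>keys m. card S = 2 \<and> separated S)"
  shows "\<exists>i. keys m \<subseteq> {i, i + 1 :: nat}"
proof (intro exI subsetI)
  fix v assume v: "v \<in> keys m"
  define i where "i = Min (keys m)"
  have i: "i \<in> keys m" "i \<le> v" unfolding i_def using v by (auto intro: Min_in)
  have "\<not> i + 2 \<le> v"
  proof
    assume "i + 2 \<le> v"
    then have "{i, v} \<subseteq> keys m \<and> card {i, v} = 2 \<and> separated {i, v}"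
      using v i by (auto simp: separated_def)
    then show False using assms by blast
  qed
  then show "v \<in> {Min (keys m), Min (keys m) + 1}" using i by (auto simp: i_def)
qed

text \<open>The average index, weight over degree, lies in both [i, i + 1] and [j, j + 1]. If
  \<open>i = j\<close>, degree and weight determine both exponents; if \<open>i < j\<close>, either
  the degree is zero or \<open>j = i + 1\<close> and both monomials are powers of the shared
  variable.\<close>

lemma standard_unique:
  assumes "keys m \<subseteq> {i, i + 1}" "keys n \<subseteq> {j, j + 1}" "mdeg m = mdeg n" "mwt m = mwt n" "i \<le> j"
  shows "m = n"
proof -
  have m: "mdeg m = lookup m i + lookup m (i+1)" "mwt m = i * lookup m i + (i+1) * lookup m (i+1)"
    using weight_superset[OF _ assms(1)] by auto
  have n: "mdeg n = lookup n j + lookup n (j+1)" "mwt n = j * lookup n j + (j+1) * lookup n (j+1)"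
    using weight_superset[OF _ assms(2)] by auto
  have m0: "lookup m v = 0" if "v \<notin> {i, i + 1}" for v using that assms(1) by (auto simp: in_keys_iff)
  have n0: "lookup n v = 0" if "v \<notin> {j, j + 1}" for v using that assms(2) by (auto simp: in_keys_iff)
  have deg: "lookup m i + lookup m (i+1) = lookup n j + lookup n (j+1)"
    using m(1) n(1) assms(3) by simp
  have "i * (lookup m i + lookup m (i+1)) + lookup m (i+1) = j * (lookup n j + lookup n (j+1)) + lookup n (j+1)"
    using m(2) n(2) assms(4) by (simp add: algebra_simps)
  then have wt: "i * (lookup m i + lookup m (i+1)) + lookup m (i+1) = j * (lookup m i + lookup m (i+1)) + lookup n (j+1)"
    unfolding deg .
  show ?thesis
  proof (cases "i = j")
    case True
    then have "lookup m v = lookup n v" for v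
      using wt deg m0[of v] n0[of v] by (cases "v = i"; cases "v = i + 1") auto
    then show ?thesis by (rule poly_mapping_eqI)
  next
    case False
    define D where "D = lookup m i + lookup m (i+1)"
    obtain k where k: "j = i + 1 + k" using False assms(5) by (metis less_eqE le_neq_implies_less Suc_eq_plus1 Suc_leI)
    have "lookup m (i+1) = D + k * D + lookup n (j+1)" using wt unfolding D_def[symmetric] k by (simp add: algebra_simps)
    then have *: "lookup m i + k * D + lookup n (j+1) = 0" by (auto simp: D_def)
    then have "D = 0 \<or> j = i + 1" using k by (cases k) auto
    then have "lookup m v = lookup n v" for v
      using * deg m0[of v] n0[of v] by (cases "v = i"; cases "v = i + 1"; cases "v = j"; cases "v = j + 1") (auto simp: D_def)
    then show ?thesis by (rule poly_mapping_eqI)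
  qed
qed

text \<open>These two monomials are the terms of the 2 x 2 minor in columns \<open>i\<close> and
  \<open>j - 1\<close>, with the larger one on its diagonal.\<close>

lemma diagonal_order_pair:
  assumes diag: "diagonal_term_order TYPE('k::comm_ring_1) d ord" and ij: "i + 2 \<le> j" "j \<le> d"
  shows "(Poly_Mapping.single (i + 1) 1 + Poly_Mapping.single (j - 1) 1, Poly_Mapping.single i 1 + Poly_Mapping.single j 1) \<in> ord"
proof -
  define c where "c = (\<lambda>b::nat. if b = 0 then i else j - 1)"
  have c: "c \<in> hankel_columns d 1"
    using ij by (auto simp: hankel_columns_def c_def strict_mono_on_def)
  have j: "Suc (j - 1) = j" using ij by simp
  have dm: "diag_monomial 1 c = Poly_Mapping.single i 1 + Poly_Mapping.single j 1"
    using j by (simp add: diag_monomial_def c_def)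
  have lead: "is_lead ord (det (hankel_minor 1 c) :: (nat, 'k) mpoly) (Poly_Mapping.single i 1 + Poly_Mapping.single j 1)"
    unfolding dm[symmetric] by (rule is_lead_hankel_minor[OF diag _ c]) simp
  define m1 m2 :: "nat monomial" where "m1 = Poly_Mapping.single i 1 + Poly_Mapping.single j 1"
    and "m2 = Poly_Mapping.single (i + 1) 1 + Poly_Mapping.single (j - 1) 1"
  have "lookup m1 i \<noteq> lookup m2 i"
    using ij by (simp add: m1_def m2_def lookup_add lookup_single when_def)
  then have ne: "m1 \<noteq> m2" by auto
  have "det (hankel_minor 1 c) = (Monom m1 - Monom m2 :: (nat, 'k) mpoly)"
    using j by (simp add: det_hankel_minor_1[simplified] c_def Var_times m1_def m2_def add.commute)
  then have "m2 \<in> keys (det (hankel_minor 1 c) :: (nat, 'k) mpoly)"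
    using ne by (simp add: in_keys_iff lookup_minus) (simp add: Monom_def lookup_single when_def)
  then show ?thesis using lead by (auto simp: is_lead_def m1_def m2_def)
qed

text \<open>
  Replacing \<open>x\<^sub>i x\<^sub>j\<close> by \<open>x\<^sub>i\<^sub>+\<^sub>1 x\<^sub>j\<^sub>-\<^sub>1\<close> decreases the monomial for the term order, and the sum of
  the squared indices too, so that the induction needs no well-foundedness of the term order.
\<close>

lemma standard_minimal:
  assumes diag: "diagonal_term_order TYPE('k::comm_ring_1) d ord"
    and m: "m \<in> monomials {..d}" "\<not> (\<exists>S\<subseteq>keys m. card S = 2 \<and> separated S)"
    and n: "n \<in> monomials {..d}" "mdeg n = mdeg m" "mwt n = mwt m"
  shows "(m, n) \<in> ord"
  using n
proof (induction "weight (\<lambda>v. v * v) n" arbitrary: n rule: less_induct)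
  case less
  have ord: "term_order {..d} ord" using diag by (simp add: diagonal_term_order_def)
  show ?case
  proof (cases "\<exists>S\<subseteq>keys n. card S = 2 \<and> separated S")
    case False
    obtain i j where ij: "keys m \<subseteq> {i, i + 1}" "keys n \<subseteq> {j, j + 1}"
      using no_separated_pair[OF m(2)] no_separated_pair[OF False] by blast
    have "m = n"
    proof (cases "i \<le> j")
      case True
      then show ?thesis by (rule standard_unique[OF ij less.prems(2,3)[symmetric]])
    next
      case False
      then show ?thesis using standard_unique[OF ij(2,1) less.prems(2,3)] by simp
    qed
    then show ?thesis using ord_refl[OF ord m(1)] by simp
  next
    case True
    then obtain S where S: "S \<subseteq> keys n" "card S = 2" "separated S" by blast
    obtain i j where ij: "i \<in> S" "j \<in> S" "i < j" using S(2)
      by (auto simp: card_2_iff) (metis insertCI linorder_neqE_nat)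
    then have ij2: "i + 2 \<le> j" using S(3) by (auto simp: separated_def)
    have jd: "j \<le> d" using ij S less.prems(1) by (auto simp: monomials_def)
    define e where "e = Poly_Mapping.single i 1 + Poly_Mapping.single j (1::nat)"
    define e' where "e' = Poly_Mapping.single (i + 1) 1 + Poly_Mapping.single (j - 1) (1::nat)"
    have "madds e n" unfolding madds_iff
      using ij S by (auto simp: e_def lookup_add lookup_single when_def in_keys_iff Suc_le_eq subset_eq)
    then obtain k where k: "n = e + k" by (auto simp: madds_def)
    have kd: "k \<in> monomials {..d}" using less.prems(1) k by simp
    obtain l where l: "j = i + 2 + l" using ij2 by (metis le_iff_add)
    have "(m, e' + k) \<in> ord"
    proof (rule less.hyps)
      \<comment> \<open>The sum of squares drops by \<open>2 * (j - i - 1)\<close>, which is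
        \<open>2 * (l + 1)\<close>.\<close>
      show "weight (\<lambda>v. v * v) (e' + k) < weight (\<lambda>v. v * v) n"
        by (simp add: k e_def e'_def weight_plus l algebra_simps)
      show "e' + k \<in> monomials {..d}" using kd ij2 jd by (auto simp: e'_def)
      show "mdeg (e' + k) = mdeg m" "mwt (e' + k) = mwt m"
        using less.prems(2,3) by (simp_all add: k e_def e'_def weight_plus l)
    qed
    moreover have "(e' + k, n) \<in> ord" unfolding k
      using ord_plus[OF ord _ kd] diagonal_order_pair[OF diag ij2 jd] by (simp add: e_def e'_def)
    ultimately show ?thesis by (rule ord_trans[OF ord])
  qed
qed

text \<open>A leading exponent without a separated pair would be both the largest exponent of
  \<open>f\<close> and the smallest of its bidegree, hence the only exponent of \<open>f\<close>
  there. Its coefficient would then be a full bidegree sum, which is zero by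
  \<open>hankel_ideal_graded\<close>.\<close>

theorem initial_hankel_ideal_subset:
  assumes diag: "diagonal_term_order TYPE('k::comm_ring_1) d ord"
  shows "initial_ideal {..d} ord (hankel_ideal d :: (nat, 'k) mpoly set) \<subseteq> separated_ideal d 1"
proof -
  have ord: "term_order {..d} ord" using diag by (simp add: diagonal_term_order_def)
  have "\<exists>S\<subseteq>keys m. card S = 2 \<and> separated S"
    if f: "f \<in> hankel_ideal d" "f \<noteq> 0" "m = lead_exp ord f" for f :: "(nat, 'k) mpoly" and m
  proof (rule ccontr)
    assume m: "\<not> (\<exists>S\<subseteq>keys m. card S = 2 \<and> separated S)"
    have fc: "f \<in> carrier (mpoly_ring {..d})" using ideal_carrier[OF ideal_hankel_ideal f(1)] .
    have lead: "is_lead ord f m" unfolding f(3) by (rule is_lead_lead_exp[OF ord fc f(2)])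
    have mV: "m \<in> monomials {..d}" unfolding f(3) by (rule lead_exp_monomials[OF ord fc f(2)])
    have "n = m" if "n \<in> keys f" "mdeg n = mdeg m" "mwt n = mwt m" for n
      using standard_minimal[OF diag mV m _ that(2,3)] that(1) fc lead ord_antisym[OF ord]
      by (auto simp: is_lead_def carrier_mpoly_ring)
    then have "pairing (\<lambda>n. if mdeg n = mdeg m \<and> mwt n = mwt m then 1 else 0) f =
        (\<Sum>n\<in>keys f. if n = m then lookup f n else 0)"
      unfolding lin_def by (intro sum.cong) auto
    also have "\<dots> \<noteq> 0" using lead by (auto simp: is_lead_def in_keys_iff)
    finally show False
      using hankel_ideal_graded[OF f(1), of "\<lambda>a b. if a = mdeg m \<and> b = mwt m then 1 else 0"] by simp
  qed
  then have "Monom (lead_exp ord f) \<in> separated_ideal d 1" if "f \<in> hankel_ideal d" "f \<noteq> 0" for f :: "(nat, 'k) mpoly"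
  proof -
    have "lead_exp ord f \<in> monomials {..d}"
      by (rule lead_exp_monomials[OF ord ideal_carrier[OF ideal_hankel_ideal]]) (use that in auto)
    then show ?thesis
      using Monom_carrier \<open>\<And>m f. \<lbrakk>f \<in> hankel_ideal d; f \<noteq> 0; m = lead_exp ord f\<rbrakk> \<Longrightarrow> _\<close>[OF that refl]
      by (auto simp: separated_ideal_iff numeral_2_eq_2)
  qed
  then show ?thesis unfolding initial_ideal_alt
    by (intro genideal_subset[OF ideal_separated_ideal]) auto
qed

subsection \<open>Hankel minors vanish on secants\<close>

lemma det_sum_rows:
  fixes f g :: "nat \<Rightarrow> nat \<Rightarrow> 'a::comm_ring_1"
  shows "det (mat n n (\<lambda>(i, j). f i j + g i j)) =
    (\<Sum>S\<in>Pow {0..<n}. det (mat n n (\<lambda>(i, j). if i \<in> S then f i j else g i j)))"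
proof -
  have d: "det (mat n n (\<lambda>(i, j). h i j)) = (\<Sum>p\<in>{p. p permutes {0..<n}}. signof p * (\<Prod>i\<in>{0..<n}. h i (p i)))"
    for h :: "nat \<Rightarrow> nat \<Rightarrow> 'a"
    by (subst det_def') (auto intro!: sum.cong prod.cong arg_cong2[where f="(*)"] simp: permutes_in_image[of _ "{0..<n}"])
  have "(\<Prod>i\<in>{0..<n}. if i \<in> S then f i (p i) else g i (p i)) = (\<Prod>i\<in>S. f i (p i)) * (\<Prod>i\<in>{0..<n} - S. g i (p i))"
    if "S \<subseteq> {0..<n}" for S p
    using that by (subst prod.If_cases) (auto simp: Int_absorb1 Diff_eq)
  then have "(\<Sum>S\<in>Pow {0..<n}. \<Sum>p\<in>{p. p permutes {0..<n}}. signof p * (\<Prod>i\<in>{0..<n}. if i \<in> S then f i (p i) else g i (p i)))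
     = (\<Sum>p\<in>{p. p permutes {0..<n}}. signof p * (\<Prod>i\<in>{0..<n}. f i (p i) + g i (p i)))"
    by (subst sum.swap) (simp add: prod_add sum_distrib_left)
  then show ?thesis unfolding d by simp
qed

text \<open>Laplace expansion along two rows, without its cofactors: pair each permutation with its
  composition with the transposition of \<open>k\<close> and \<open>l\<close>. The signs are
  opposite, so the two terms add up to a 2 x 2 minor times the remaining factors.\<close>

lemma det_two_rows_in_ideal:
  fixes f :: "nat \<Rightarrow> nat \<Rightarrow> ('v, 'k::comm_ring_1) mpoly"
  assumes K: "ideal K (mpoly_ring V)"
    and f: "\<And>i j. i < n \<Longrightarrow> j < n \<Longrightarrow> f i j \<in> carrier (mpoly_ring V)"
    and kl: "k < l" "l < n"
    and minor: "\<And>a b. a < n \<Longrightarrow> b < n \<Longrightarrow> f k a * f l b - f k b * f l a \<in> K"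
  shows "det (mat n n (\<lambda>(i, j). f i j)) \<in> K"
proof -
  let ?N = "{0..<n}"
  define P where "P = {p. p permutes ?N}"
  define P1 where "P1 = {p \<in> P. p k < p l}"
  define P2 where "P2 = {p \<in> P. p l < p k}"
  define t where "t = Transposition.transpose k l"
  define F where "F p = signof p * (\<Prod>i\<in>?N. f i (p i))" for p
  have d: "det (mat n n (\<lambda>(i, j). f i j)) = (\<Sum>p\<in>P. F p)"
    unfolding P_def F_def
    by (subst det_def') (auto intro!: sum.cong prod.cong arg_cong2[where f="(*)"] simp: permutes_in_image[of _ "{0..<n}"])
  have t: "t permutes ?N" unfolding t_def by (rule permutes_swap_id) (use kl in auto)
  have fin: "finite P" unfolding P_def by (rule finite_permutations) simp
  have pne: "p k \<noteq> p l" if "p \<in> P" for p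
    using that kl permutes_inj[of p ?N] by (auto simp: P_def dest: injD)
  have "p k < p l \<or> p l < p k" if "p \<in> P" for p using pne[OF that] by (rule linorder_neqE_nat) auto
  then have PU: "P = P1 \<union> P2" unfolding P1_def P2_def by blast
  have tt: "t \<circ> t = id" by (simp add: t_def fun_eq_iff)
  have bij: "bij_betw (\<lambda>p. p \<circ> t) P1 P2"
  proof (rule bij_betwI[where g = "\<lambda>p. p \<circ> t"])
    show "(\<lambda>p. p \<circ> t) \<in> P1 \<rightarrow> P2" "(\<lambda>p. p \<circ> t) \<in> P2 \<rightarrow> P1"
      using permutes_compose[OF t] by (auto simp: P1_def P2_def P_def t_def)
  qed (simp_all add: comp_assoc tt)
  have "(\<Sum>p\<in>P. F p) = (\<Sum>p\<in>P1. F p) + (\<Sum>p\<in>P2. F p)"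
    unfolding PU by (rule sum.union_disjoint) (use fin in \<open>auto simp: P1_def P2_def\<close>)
  also have "(\<Sum>p\<in>P2. F p) = (\<Sum>p\<in>P1. F (p \<circ> t))"
    by (rule sum.reindex_bij_betw[OF bij, symmetric])
  finally have sum: "(\<Sum>p\<in>P. F p) = (\<Sum>p\<in>P1. F p + F (p \<circ> t))" by (simp add: sum.distrib)
  have "F p + F (p \<circ> t) \<in> K" if p: "p \<in> P1" for p
  proof -
    have pp: "p permutes ?N" using p by (simp add: P1_def P_def)
    have pn: "p i < n" if "i < n" for i using permutes_in_image[OF pp, of i] that by simp
    define R where "R = (\<Prod>i\<in>?N - {k, l}. f i (p i))"
    have Nkl: "?N = insert k (insert l (?N - {k, l}))" using kl by auto
    have split: "(\<Prod>i\<in>?N. g i) = g k * (g l * (\<Prod>i\<in>?N - {k, l}. g i))" for g :: "nat \<Rightarrow> ('v, 'k) mpoly"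
      by (subst Nkl) (use kl in auto)
    have sg: "signof (p \<circ> t) = - (signof p :: ('v, 'k) mpoly)"
    proof -
      have "signof (p \<circ> t) = (signof p * signof t :: ('v, 'k) mpoly)"
        by (rule signof_compose[OF pp t])
      also have "signof t = (-1 :: ('v, 'k) mpoly)"
        unfolding t_def using kl by (simp add: sign_swap_id)
      finally show ?thesis by (simp add: o_def)
    qed
    have "(\<Prod>i\<in>?N - {k, l}. f i ((p \<circ> t) i)) = R"
      unfolding R_def t_def by (rule prod.cong) (auto simp: Transposition.transpose_def)
    then have "F p + F (p \<circ> t) = signof p * R * (f k (p k) * f l (p l) - f k (p l) * f l (p k))"
      unfolding F_def split sg by (simp add: R_def[symmetric]) (simp add: t_def algebra_simps)
    moreover have "R \<in> carrier (mpoly_ring V)"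
      unfolding R_def by (rule prod_carrier) (use f pn in auto)
    moreover have "signof p \<in> carrier (mpoly_ring V :: ('v, 'k) mpoly ring)"
      by (cases "sign p = (1::int)") (auto simp: sign_def one_carrier uminus_carrier)
    ultimately show ?thesis
      using ideal_mult[OF K minor[OF pn pn] mult_carrier] kl by simp
  qed
  then show ?thesis unfolding d sum by (rule ideal_sum[OF K])
qed

text \<open>The generators only provide \<open>i < j\<close>; swapping the indices changes the sign,
  and equal indices give zero.\<close>

lemma hankel_ideal_step:
  assumes "i < d" "j < d"
  shows "Var i * Var (j + 1) - Var (i + 1) * Var j \<in> (hankel_ideal d :: (nat, 'k::comm_ring_1) mpoly set)"
proof -
  have less: "Var i * Var (j + 1) - Var (i + 1) * Var j \<in> (hankel_ideal d :: (nat, 'k) mpoly set)"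
    if "i < j" "j < d" for i j
  proof -
    define c where "c = (\<lambda>b::nat. if b = 0 then i else j)"
    have "c \<in> hankel_columns d 1"
      using that by (auto simp: hankel_columns_def c_def strict_mono_on_def)
    then have "det (hankel_minor 1 c) \<in> (hankel_ideal d :: (nat, 'k) mpoly set)"
      unfolding hankel_ideal_alt using genideal_self[OF minors_hankel_1_carrier] by blast
    then show ?thesis by (simp add: det_hankel_minor_1[simplified] c_def mult.commute)
  qed
  consider "i < j" | "i = j" | "j < i" by linarith
  then show ?thesis
  proof cases
    case 2
    then show ?thesis using ideal_zero[OF ideal_hankel_ideal] by (simp add: mult.commute)
  next
    case 3
    then show ?thesis
      using ideal_uminus[OF ideal_hankel_ideal less[OF 3 assms(1)]] by (simp add: mult.commute)
  qed (use less assms in auto)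
qed

text \<open>A telescoping sum of single steps, raising one index while lowering the other.\<close>

lemma hankel_ideal_shift:
  assumes "i + k \<le> d" "j + k \<le> d"
  shows "Var i * Var (j + k) - Var (i + k) * Var j \<in> (hankel_ideal d :: (nat, 'k::comm_ring_1) mpoly set)"
  using assms
proof (induction k arbitrary: i)
  case 0
  then show ?case using ideal_zero[OF ideal_hankel_ideal] by simp
next
  case (Suc k)
  have "Var i * Var (j + k + 1) - Var (i + 1) * Var (j + k) \<in> (hankel_ideal d :: (nat, 'k) mpoly set)"
    by (rule hankel_ideal_step) (use Suc.prems in auto)
  moreover have "Var (i + 1) * Var (j + k) - Var (i + 1 + k) * Var j \<in> (hankel_ideal d :: (nat, 'k) mpoly set)"
    by (rule Suc.IH) (use Suc.prems in auto)
  ultimately show ?case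
    using ideal_add[OF ideal_hankel_ideal] by fastforce
qed

text \<open>Two index pairs of equal sum differ by a shift in one direction or the other. In this
  form it covers 2 x 2 minors with arbitrary row and column offsets.\<close>

lemma hankel_ideal_binomial:
  assumes "i + j = k + l" "i \<le> d" "j \<le> d" "k \<le> d" "l \<le> d"
  shows "Var i * Var j - Var k * Var l \<in> (hankel_ideal d :: (nat, 'k::comm_ring_1) mpoly set)"
proof (cases "i \<le> k")
  case True
  then obtain t where "k = i + t" by (metis le_iff_add)
  then show ?thesis using hankel_ideal_shift[of i t d l] assms by (simp add: add.commute)
next
  case False
  then obtain t where "i = k + t" by (metis le_iff_add nat_le_linear)
  moreover from this have "l = j + t" using assms(1) by simp
  ultimately show ?thesis
    using ideal_uminus[OF ideal_hankel_ideal hankel_ideal_shift[of k t d j]] assms by simp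
qed

lemma secant_hankel_carrier:
  assumes "r \<ge> 1"
  shows "secant_ideal {..d} (hankel_ideal d) r \<subseteq> carrier (mpoly_ring {..d})"
  using ideal_carrier[OF ideal_secant_ideal[OF ideal_hankel_ideal assms]] by blast

text \<open>
  Allowing arbitrary rows and columns, not just those of the matrix \<open>X\<^sub>r\<close>, makes the statement
  stable under the Laplace expansion.  After substituting \<open>y + z\<close>, a determinant becomes a sum over
  the ways of choosing each row from \<open>y\<close> or from \<open>z\<close>: two \<open>z\<close>-rows give an element of
  \<open>I(z)\<close>, and at most one \<open>z\<close>-row leaves minors that are smaller by one in \<open>y\<close>.
\<close>

lemma hankel_det_in_secant_ideal:
  assumes "r \<ge> 1" "\<And>i j. i \<le> r \<Longrightarrow> j \<le> r \<Longrightarrow> a i + b j \<le> d"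
  shows "det (mat (r + 1) (r + 1) (\<lambda>(i, j). Var (a i + b j)))
    \<in> secant_ideal {..d} (hankel_ideal d :: (nat, 'k::comm_ring_1) mpoly set) r"
  using assms
proof (induction r arbitrary: a b rule: dec_induct)
  case base
  have "Var (a 0 + b 0) * Var (a 1 + b 1) - Var (a 0 + b 1) * Var (a 1 + b 0) \<in> (hankel_ideal d :: (nat, 'k) mpoly set)"
    by (rule hankel_ideal_binomial) (use base in auto)
  then show ?case
    using det_mat_2[of "\<lambda>(i, j). Var (a i + b j) :: (nat, 'k) mpoly"] by (simp add: numeral_2_eq_2)
next
  case (step r)
  let ?V = "{..d}"
  let ?I = "hankel_ideal d :: (nat, 'k) mpoly set"
  let ?J = "secant_ideal ?V ?I r"
  let ?n = "Suc r + 1"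
  let ?M = "mat ?n ?n (\<lambda>(i, j). Var (a i + b j)) :: (nat, 'k) mpoly mat"
  let ?R = "mpoly_ring (XYZ ?V) :: (nat xyz, 'k) mpoly ring"
  have I: "?I \<subseteq> carrier (mpoly_ring ?V)" using ideal_carrier[OF ideal_hankel_ideal] by blast
  note J = secant_hankel_carrier[OF step.hyps(1), of d, where 'a='k]
  let ?G = "genideal ?R (join_gens ?V ?J ?I)"
  note G = ideal_genideal[OF join_gens_carrier[OF J I]]
  note Gs = genideal_self[OF join_gens_carrier[OF J I]]
  have ab: "a i + b j \<in> ?V" if "i < ?n" "j < ?n" for i j using step.prems[of i j] that by auto
  interpret s: comm_ring_hom "subst_vars (\<lambda>v. Var (Yv v) + Var (Zv v)) :: (nat, 'k) mpoly \<Rightarrow> (nat xyz, 'k) mpoly"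
    by (rule comm_ring_hom_subst_vars)
  interpret y: comm_ring_hom "subst_vars (\<lambda>v. Var (Yv v)) :: (nat, 'k) mpoly \<Rightarrow> (nat xyz, 'k) mpoly"
    by (rule comm_ring_hom_subst_vars)
  interpret z: comm_ring_hom "subst_vars (\<lambda>v. Var (Zv v)) :: (nat, 'k) mpoly \<Rightarrow> (nat xyz, 'k) mpoly"
    by (rule comm_ring_hom_subst_vars)
  define Y Z where "Y i j = (Var (Yv (a i + b j)) :: (nat xyz, 'k) mpoly)"
    and "Z i j = (Var (Zv (a i + b j)) :: (nat xyz, 'k) mpoly)" for i j
  have YZ: "Y i j \<in> carrier ?R" "Z i j \<in> carrier ?R" if "i < ?n" "j < ?n" for i j
    using ab[OF that] by (auto simp: Y_def Z_def intro: Var_carrier)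
  define F where "F S i j = (if i \<in> S then Y i j else Z i j)" for S i j
  have "det (mat ?n ?n (\<lambda>(i, j). F S i j)) \<in> ?G" for S
  proof (cases "\<exists>k l. k < l \<and> l < ?n \<and> k \<notin> S \<and> l \<notin> S")
    case True
    then obtain k l where kl: "k < l" "l < ?n" "k \<notin> S" "l \<notin> S" by blast
    show ?thesis
    proof (rule det_two_rows_in_ideal[OF G _ kl(1,2)])
      show "F S i j \<in> carrier ?R" if "i < ?n" "j < ?n" for i j
        using YZ[OF that] by (simp add: F_def)
      fix i j assume ij: "i < ?n" "j < ?n"
      define f :: "(nat, 'k) mpoly" where
        "f = Var (a k + b i) * Var (a l + b j) - Var (a k + b j) * Var (a l + b i)"
      have "f \<in> ?I" unfolding f_def
        by (rule hankel_ideal_binomial) (use ab[of k] ab[of l] ij kl in auto)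
      moreover have "subst_vars (\<lambda>v. Var (Zv v)) f = F S k i * F S l j - F S k j * F S l i"
        using kl by (simp add: f_def z.hom_minus z.hom_mult F_def Z_def)
      ultimately show "F S k i * F S l j - F S k j * F S l i \<in> ?G"
        using Gs by (force simp: join_gens_def)
    qed
  next
    case False
    \<comment> \<open>\<open>k\<close> is the only z-row, or any row if there is none. Expanding
      along it leaves cofactors built from y-rows only.\<close>
    have "\<exists>k<?n. \<forall>i<?n. i \<noteq> k \<longrightarrow> i \<in> S"
    proof (cases "\<exists>k<?n. k \<notin> S")
      case True
      then show ?thesis using False by (metis linorder_neqE_nat)
    qed auto
    then obtain k where k: "k < ?n" "\<And>i. i < ?n \<Longrightarrow> i \<noteq> k \<Longrightarrow> i \<in> S" by blast
    let ?A = "mat ?n ?n (\<lambda>(i, j). F S i j)"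
    have cof: "cofactor ?A k j \<in> ?G" if j: "j < ?n" for j
    proof -
      \<comment> \<open>\<open>ins k\<close> enumerates the indices other than \<open>k\<close>.
        Composing \<open>a\<close> and \<open>b\<close> with such maps turns the cofactor into a
        determinant of the shape required by the induction hypothesis.\<close>
      define ins where "ins k i = (if i < k then i else Suc i)" for k i :: nat
      define B where "B = (mat (r + 1) (r + 1) (\<lambda>(i', j'). Var (a (ins k i') + b (ins j j'))) :: (nat, 'k) mpoly mat)"
      have ins: "ins l i < ?n" "ins l i \<noteq> l" if "i < r + 1" "l < ?n" for i l using that by (auto simp: ins_def)
      have "det B \<in> ?J" unfolding B_def
        by (rule step.IH) (use ab ins k(1) j in \<open>auto simp: less_Suc_eq_le\<close>)
      then have "subst_vars (\<lambda>v. Var (Yv v)) (det B) \<in> ?G"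
        using Gs by (force simp: join_gens_def)
      moreover have "mat_delete ?A k j = map_mat (subst_vars (\<lambda>v. Var (Yv v))) B"
      proof (rule eq_matI)
        fix i' j' assume "i' < dim_row (map_mat (subst_vars (\<lambda>v. Var (Yv v)) :: _ \<Rightarrow> (nat xyz, 'k) mpoly) B)"
          "j' < dim_col (map_mat (subst_vars (\<lambda>v. Var (Yv v)) :: _ \<Rightarrow> (nat xyz, 'k) mpoly) B)"
        then have ij: "i' < r + 1" "j' < r + 1" by (auto simp: B_def)
        have "mat_delete ?A k j $$ (i', j') = F S (ins k i') (ins j j')"
          using ij ins[OF ij(1) k(1)] ins[OF ij(2) j] by (simp add: mat_delete_def ins_def[symmetric])
        also have "\<dots> = Y (ins k i') (ins j j')"
          using k(2) ins[OF ij(1) k(1)] by (simp add: F_def)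
        finally show "mat_delete ?A k j $$ (i', j') = map_mat (subst_vars (\<lambda>v. Var (Yv v))) B $$ (i', j')"
          using ij by (simp add: B_def Y_def)
      qed (auto simp: B_def mat_delete_def)
      ultimately show ?thesis unfolding cofactor_def y.hom_det[symmetric]
        by (intro ideal_mult[OF G] power_carrier uminus_carrier one_carrier) simp
    qed
    have "det ?A = (\<Sum>j<?n. ?A $$ (k, j) * cofactor ?A k j)"
      by (rule laplace_expansion_row[OF _ k(1)]) simp
    also have "\<dots> \<in> ?G"
      by (rule ideal_sum[OF G], rule ideal_mult[OF G cof]) (use YZ k(1) in \<open>auto simp: F_def\<close>)
    finally show ?thesis .
  qed
  then have "(\<Sum>S\<in>Pow {0..<?n}. det (mat ?n ?n (\<lambda>(i, j). F S i j))) \<in> ?G"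
    by (intro ideal_sum[OF G])
  then have "det (mat ?n ?n (\<lambda>(i, j). Y i j + Z i j)) \<in> ?G"
    unfolding det_sum_rows F_def .
  moreover have "subst_vars (\<lambda>v. Var (Yv v) + Var (Zv v)) (det ?M) = det (mat ?n ?n (\<lambda>(i, j). Y i j + Z i j))"
    unfolding s.hom_det[symmetric] by (rule arg_cong[where f=det]) (auto simp: Y_def Z_def)
  moreover have "det ?M \<in> carrier (mpoly_ring ?V)"
    by (rule det_mat_carrier) (use ab in \<open>auto intro: Var_carrier\<close>)
  ultimately have "det ?M \<in> join_ideal ?V ?J ?I"
    by (intro join_idealI[OF J I]) auto
  then show ?case using step.hyps(1) by (simp add: secant_ideal_Suc)
qed

subsection \<open>Well-foundedness of term orders\<close>

text \<open>The sequence form of Dickson's lemma: refine the subsequence for one variable at a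
  time.\<close>

lemma exists_monotone_subsequence:
  fixes f :: "nat \<Rightarrow> 'v monomial"
  assumes "finite V"
  shows "\<exists>s. strict_mono s \<and> (\<forall>v\<in>V. incseq (\<lambda>i. lookup (f (s i)) v))"
  using assms
proof (induction V rule: finite_induct)
  case empty
  then show ?case by (intro exI[of _ id]) (auto simp: strict_mono_def)
next
  case (insert v V)
  then obtain s where s: "strict_mono s" "\<forall>v\<in>V. incseq (\<lambda>i. lookup (f (s i)) v)" by blast
  define g where "g i = lookup (f (s i)) v" for i
  obtain h where h: "strict_mono h" "monoseq (\<lambda>i. g (h i))"
    using seq_monosub[of g] by blast
  have "\<exists>N. incseq (\<lambda>i. g (h (N + i)))"
  proof (cases "incseq (\<lambda>i. g (h i))")
    case True
    then show ?thesis by (intro exI[of _ 0]) simp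
  next
    case False
    then have dec: "decseq (\<lambda>i. g (h i))" using h(2) by (simp add: monoseq_iff)
    \<comment> \<open>A decreasing sequence of naturals is constant, hence also increasing, from a
      point \<open>N\<close> where its minimum is attained.\<close>
    define N where "N = (ARG_MIN (\<lambda>i. g (h i)) i. True)"
    have "g (h N) \<le> g (h i)" for i unfolding N_def by (rule arg_min_nat_le) simp
    moreover have "g (h (N + i)) \<le> g (h N)" for i using dec by (rule decseqD) simp
    ultimately have "g (h (N + i)) = g (h N)" for i by (meson le_antisym)
    then show ?thesis by (intro exI[of _ N]) (simp add: incseq_def)
  qed
  then obtain N where N: "incseq (\<lambda>i. g (h (N + i)))" by blast
  have hN: "strict_mono (\<lambda>i. h (N + i))" using h(1) by (auto simp: strict_mono_def)
  have "incseq (\<lambda>i. lookup (f (s (h (N + i)))) w)" if "w \<in> insert v V" for w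
  proof (cases "w = v")
    case True
    then show ?thesis using N by (simp add: g_def)
  next
    case False
    then have "incseq (\<lambda>i. lookup (f (s i)) w)" using that s(2) by blast
    then show ?thesis using strict_mono_mono[OF hN] by (auto simp: incseq_def mono_def)
  qed
  moreover have "strict_mono (\<lambda>i. s (h (N + i)))" using s(1) hN by (auto simp: strict_mono_def)
  ultimately show ?case by (intro exI[of _ "\<lambda>i. s (h (N + i))"]) blast
qed

text \<open>In a descending chain, the monotone subsequence makes an earlier monomial divide a later
  one. Divisors are smaller for a term order, which contradicts strict descent.\<close>

lemma wf_term_order:
  assumes ord: "term_order V ord" and "finite V"
  shows "wf {(m, n). m \<in> monomials V \<and> n \<in> monomials V \<and> (m, n) \<in> ord \<and> m \<noteq> n}" (is "wf ?R")
  unfolding wf_iff_no_infinite_down_chain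
proof
  assume "\<exists>f. \<forall>i. (f (Suc i), f i) \<in> ?R"
  then obtain f where f: "\<And>i. (f (Suc i), f i) \<in> ?R" by blast
  have fV: "f i \<in> monomials V" for i using f[of i] by auto
  have le: "(f (i + k), f i) \<in> ord" for i k
  proof (induction k)
    case (Suc k)
    then show ?case using f[of "i + k"] ord_trans[OF ord] by auto
  qed (simp add: ord_refl[OF ord fV])
  obtain s where s: "strict_mono s" "\<forall>v\<in>V. incseq (\<lambda>i. lookup (f (s i)) v)"
    using exists_monotone_subsequence[OF assms(2)] by blast
  have "madds (f (s 0)) (f (s 1))"
    unfolding madds_iff
  proof
    fix v show "lookup (f (s 0)) v \<le> lookup (f (s 1)) v"
    proof (cases "v \<in> V")
      case True
      then show ?thesis using s(2) by (auto simp: incseq_def)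
    next
      case False
      then have "lookup (f (s 0)) v = 0" using fV[of "s 0"] by (auto simp: monomials_def in_keys_iff)
      then show ?thesis by simp
    qed
  qed
  then obtain k where k: "f (s 1) = f (s 0) + k" by (auto simp: madds_def)
  then have "k \<in> monomials V" using fV[of "s 1"] by simp
  then have "(0 + f (s 0), k + f (s 0)) \<in> ord" using ord_plus[OF ord ord_zero[OF ord]] fV by blast
  then have 1: "(f (s 0), f (s 1)) \<in> ord" unfolding k by (simp add: add.commute)
  have "s 0 < s 1" using s(1) by (simp add: strict_mono_def)
  then obtain j where j: "s 1 = Suc (s 0) + j" by (metis less_iff_Suc_add add_Suc)
  have "(f (s 1), f (Suc (s 0))) \<in> ord" using le[of "Suc (s 0)" j] unfolding j .
  then have "(f (s 0), f (Suc (s 0))) \<in> ord" using 1 ord_trans[OF ord] by blast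
  then show False using f[of "s 0"] ord_antisym[OF ord] by auto
qed

lemma lookup_Monom_times: "lookup (Monom k * g) (k + l) = (lookup g l :: 'k::comm_ring_1)"
proof -
  have "Monom k * g = (\<Sum>n\<in>keys g. Monom k * Poly_Mapping.single n (lookup g n))"
    by (simp add: sum_distrib_left[symmetric] poly_mapping_sum_single)
  then have "Monom k * g = (\<Sum>n\<in>keys g. Poly_Mapping.single (k + n) (lookup g n))"
    by (simp add: Monom_def mult_single)
  then show ?thesis by (simp add: lookup_sum lookup_single when_def in_keys_iff)
qed

text \<open>Division: some multiple \<open>q\<close> of an element of \<open>A\<close> has the
  leading term of \<open>f\<close>. Since \<open>A\<close> lies in \<open>B\<close>, the remainder
  stays in \<open>B\<close>, and its leading exponent is smaller, so well-founded induction
  applies.\<close>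

theorem ideal_eq_of_initial_ideal_subset:
  fixes A B :: "('v, 'k::field) mpoly set"
  assumes ord: "term_order V ord" and "finite V"
    and A: "ideal A (mpoly_ring V)" and B: "ideal B (mpoly_ring V)" and AB: "A \<subseteq> B"
    and init: "initial_ideal V ord B \<subseteq> initial_ideal V ord A"
  shows "A = B"
proof
  let ?R = "{(m, n). m \<in> monomials V \<and> n \<in> monomials V \<and> (m, n) \<in> ord \<and> m \<noteq> n}"
  have Ac: "A \<subseteq> carrier (mpoly_ring V)" and Bc: "B \<subseteq> carrier (mpoly_ring V)"
    using ideal_carrier A B by blast+
  have "f \<in> A" if "f \<in> B" "f \<noteq> 0" "m = lead_exp ord f" for f m
    using that
  proof (induction m arbitrary: f rule: wf_induct_rule[OF wf_term_order[OF ord \<open>finite V\<close>]])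
    case (1 m)
    have fc: "f \<in> carrier (mpoly_ring V)" using 1 Bc by blast
    have lf: "is_lead ord f m" using is_lead_lead_exp[OF ord fc] 1 by simp
    have mV: "m \<in> monomials V" using lead_exp_monomials[OF ord fc] 1 by simp
    have "Monom m \<in> initial_ideal V ord B"
      unfolding Monom_initial_ideal_iff[OF ord Bc mV] using 1 by (intro bexI[of _ f]) (auto simp: madds_iff)
    then have "Monom m \<in> initial_ideal V ord A" using init by blast
    then obtain g where g: "g \<in> A" "g \<noteq> 0" "madds (lead_exp ord g) m"
      unfolding Monom_initial_ideal_iff[OF ord Ac mV] by blast
    define l where "l = lead_exp ord g"
    obtain k where k: "m = k + l" using g(3) by (auto simp: madds_def l_def add.commute)
    have kV: "k \<in> monomials V" using mV k by simp
    have lg: "is_lead ord g l" unfolding l_def using is_lead_lead_exp[OF ord] g Ac by blast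
    define c where "c = lookup f m / lookup g l"
    define q where "q = Const c * Monom k * g"
    define h where "h = f - q"
    have qA: "q \<in> A" unfolding q_def using kV by (intro ideal_mult[OF A g(1)] mult_carrier Const_carrier Monom_carrier)
    have hB: "h \<in> B" unfolding h_def using qA AB 1 by (intro ideal_diff[OF B]) auto
    have q: "q = Poly_Mapping.map ((*) c) (Monom k * g)"
      by (simp add: q_def mult_map_scale_conv_mult Const_def mult.assoc)
    have "lookup q m = lookup f m"
      unfolding q using lg by (simp add: map.rep_eq k lookup_Monom_times c_def when_def is_lead_def in_keys_iff)
    then have hm: "m \<notin> keys h" by (simp add: h_def in_keys_iff lookup_minus)
    have kq: "keys q \<subseteq> {k + n |n. n \<in> keys g}"
    proof -
      have "keys q \<subseteq> keys (Monom k * g)" unfolding q by (auto simp: in_keys_iff map.rep_eq when_def split: if_splits)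
      also have "\<dots> \<subseteq> {k + n |n. n \<in> keys g}" using Poly_Mapping.keys_mult[of "Monom k" g] by auto
      finally show ?thesis .
    qed
    have "(n, m) \<in> ord" if "n \<in> keys h" for n
    proof -
      have "n \<in> keys f \<or> n \<in> keys q" using that keys_diff[of f q] by (auto simp: h_def)
      then show ?thesis
      proof
        assume "n \<in> keys q"
        then obtain n' where n': "n = k + n'" "n' \<in> keys g" using kq by blast
        then have "(n' + k, l + k) \<in> ord" using lg ord_plus[OF ord _ kV] by (auto simp: is_lead_def)
        then show ?thesis by (simp add: n' k add.commute)
      qed (use lf in \<open>auto simp: is_lead_def\<close>)
    qed
    have "h \<in> A"
    proof (cases "h = 0")
      case True
      then show ?thesis using ideal_zero[OF A] by simp
    next
      case False
      have hc: "h \<in> carrier (mpoly_ring V)" using hB Bc by blast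
      have "is_lead ord h (lead_exp ord h)" by (rule is_lead_lead_exp[OF ord hc False])
      then have "lead_exp ord h \<noteq> m" "(lead_exp ord h, m) \<in> ord"
        using hm \<open>\<And>n. n \<in> keys h \<Longrightarrow> (n, m) \<in> ord\<close> by (auto simp: is_lead_def)
      then show ?thesis
        using 1(1)[of "lead_exp ord h" h] mV lead_exp_monomials[OF ord hc False] hB False by auto
    qed
    then have "h + q \<in> A" using qA by (rule ideal_add[OF A])
    then show ?case by (simp add: h_def)
  qed
  then show "B \<subseteq> A" using ideal_zero[OF A] by (metis subsetI)
qed (rule AB)

subsection \<open>The chain of initial ideals\<close>

lemma initial_secant_ideal_subset:
  fixes I :: "('v, 'k::field) mpoly set"
  assumes ord: "term_order V ord" and I: "ideal I (mpoly_ring V)" and "r \<ge> 1"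
  shows "initial_ideal V ord (secant_ideal V I r) \<subseteq> secant_ideal V (initial_ideal V ord I) r"
  using assms(3)
proof (induction r rule: dec_induct)
  case (step r)
  have Ic: "I \<subseteq> carrier (mpoly_ring V)" using ideal_carrier[OF I] by blast
  note inI = ideal_initial_ideal[OF ord Ic]
  have "initial_ideal V ord (join_ideal V (secant_ideal V I r) I)
      \<subseteq> join_ideal V (initial_ideal V ord (secant_ideal V I r)) (initial_ideal V ord I)"
    by (rule initial_ideal_join_subset[OF ord ideal_secant_ideal[OF I step(1)] I])
  also have "\<dots> \<subseteq> join_ideal V (secant_ideal V (initial_ideal V ord I) r) (initial_ideal V ord I)"
    by (rule join_ideal_mono[OF step(3)])
       (use ideal_carrier[OF inI] ideal_carrier[OF ideal_secant_ideal[OF inI step(1)]] in auto)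
  finally show ?case using step(1) by (simp add: secant_ideal_Suc)
qed simp

lemma secant_ideal_mono:
  assumes "I \<subseteq> I'" "ideal I' (mpoly_ring V)" "r \<ge> 1"
  shows "secant_ideal V I r \<subseteq> secant_ideal V I' r"
  using assms(3)
proof (induction r rule: dec_induct)
  case (step r)
  then show ?case
    using join_ideal_mono[OF step(3) assms(1)] ideal_carrier[OF assms(2)]
      ideal_carrier[OF ideal_secant_ideal[OF assms(2) step(1)]]
    by (simp add: secant_ideal_Suc subsetI)
qed (simp add: assms(1))

text \<open>The diagonal entry in row k has index \<open>k + c k\<close>, which dictates
  \<open>c k = pick S k - k\<close>; the subtraction is exact by \<open>ge\<close>. Gaps of at least
  two leave \<open>c\<close> strictly increasing and, counted down from the largest element, give
  \<open>c k + r <= d\<close>.\<close>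

lemma separated_set_eq_diagonal:
  assumes "S \<in> separated_sets d r"
  shows "\<exists>c\<in>hankel_columns d r. diag_monomial r c = squarefree_monomial S"
proof -
  have S: "S \<subseteq> {..d}" "card S = r + 1" "separated S" "finite S"
    using assms separated_sets_finite[OF assms] by (auto simp: separated_sets_def)
  have pS: "pick S k \<in> S" if "k \<le> r" for k using pick_in_set_le[of k S] that S(2) by simp
  have gap: "pick S k + 2 \<le> pick S (Suc k)" if "Suc k \<le> r" for k
    using S(3) pS[of k] pS[of "Suc k"] pick_mono_le[of "Suc k" S k] that S(2) by (auto simp: separated_def)
  have gaps: "pick S k + 2 * t \<le> pick S (k + t)" if "k + t \<le> r" for k t
    using that
  proof (induction t)
    case (Suc t)
    then show ?case using gap[of "k + t"] by simp
  qed simp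
  define c where "c k = pick S k - k" for k
  have ge: "k \<le> pick S k" if "k \<le> r" for k using gaps[of 0 k] that by simp
  have "c a < c b" if "a < b" "b \<le> r" for a b
  proof -
    obtain t where t: "b = a + t" using le_Suc_ex[OF less_imp_le[OF \<open>a < b\<close>]] by blast
    then show ?thesis using gaps[of a t] ge[of a] that by (simp add: c_def)
  qed
  moreover have "c b + r \<le> d" if "b \<le> r" for b
  proof -
    obtain t where t: "r = b + t" using le_Suc_ex[OF \<open>b \<le> r\<close>] by blast
    have "pick S r \<le> d" using pS[of r] S(1) by auto
    then show ?thesis using gaps[of b t] ge[of b] t by (simp add: c_def)
  qed
  ultimately have "c \<in> hankel_columns d r" by (auto simp: hankel_columns_def strict_mono_on_def)
  moreover have "diag_monomial r c = squarefree_monomial S"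
  proof -
    have "pick S a < pick S b" if "a < b" "b \<le> r" for a b
      using pick_mono_le[of b S a] that S(2) by simp
    then have inj: "inj_on (pick S) {0..<r + 1}"
      by (intro linorder_inj_onI') (fastforce simp: less_Suc_eq_le)
    have "pick S ` {0..<r + 1} = S"
      by (rule card_subset_eq) (use S pS card_image[OF inj] in \<open>auto simp: less_Suc_eq_le\<close>)
    then have "squarefree_monomial S = (\<Sum>k\<in>{0..<r + 1}. Poly_Mapping.single (pick S k) 1)"
      unfolding squarefree_monomial_def using sum.reindex[OF inj, of "\<lambda>s. Poly_Mapping.single s (1::nat)"] by simp
    also have "\<dots> = diag_monomial r c"
      unfolding diag_monomial_def by (rule sum.cong) (use ge in \<open>auto simp: c_def less_Suc_eq_le\<close>)
    finally show ?thesis by simp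
  qed
  ultimately show ?thesis by blast
qed

theorem theorem6p2:
  fixes d :: nat and ord :: "nat monomial rel"
  assumes "d \<ge> 1"
    and "diagonal_term_order TYPE('k::alg_closed_field) d ord"
  shows "delightful {..d} ord (hankel_ideal d :: (nat, 'k) mpoly set) \<and>
    (\<forall>r\<ge>1.
      genideal (mpoly_ring {..d}) (minors (r + 1) (hankel d r))
        = secant_ideal {..d} (hankel_ideal d :: (nat, 'k) mpoly set) r \<and>
      groebner_basis {..d} ord
        (secant_ideal {..d} (hankel_ideal d :: (nat, 'k) mpoly set) r)
        (minors (r + 1) (hankel d r)))"
proof -
  let ?V = "{..d}"
  let ?I = "hankel_ideal d :: (nat, 'k) mpoly set"
  have ord: "term_order ?V ord" using assms(2) by (simp add: diagonal_term_order_def)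
  note I = ideal_hankel_ideal[of d, where 'a='k]
  have main: "initial_ideal ?V ord (secant_ideal ?V ?I r) = secant_ideal ?V (initial_ideal ?V ord ?I) r \<and>
     genideal (mpoly_ring ?V) (minors (r + 1) (hankel d r)) = secant_ideal ?V ?I r \<and>
     groebner_basis ?V ord (secant_ideal ?V ?I r) (minors (r + 1) (hankel d r))" if r: "r \<ge> 1" for r
  proof -
    let ?M = "minors (r + 1) (hankel d r) :: (nat, 'k) mpoly set"
    let ?D = "genideal (mpoly_ring ?V) ?M"
    let ?L = "genideal (mpoly_ring ?V) {lead_mono ord g |g. g \<in> ?M \<and> g \<noteq> 0}"
    note J = ideal_secant_ideal[OF I r]
    note Mc = minors_hankel_carrier[of r d, where 'a='k]
    note D = ideal_genideal[OF Mc]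
    have MJ: "?M \<subseteq> secant_ideal ?V ?I r"
    proof
      fix x assume "x \<in> ?M"
      then obtain c where c: "c \<in> hankel_columns d r" "x = det (hankel_minor r c)"
        unfolding minors_hankel by blast
      show "x \<in> secant_ideal ?V ?I r" unfolding c(2) hankel_minor_def
        by (rule hankel_det_in_secant_ideal[OF r, of "\<lambda>i. i"]) (use c(1) in \<open>force simp: hankel_columns_def\<close>)
    qed
    have DJ: "?D \<subseteq> secant_ideal ?V ?I r" by (rule genideal_subset[OF J MJ])
    have Lc: "{lead_mono ord g |g. g \<in> ?M \<and> g \<noteq> 0} \<subseteq> carrier (mpoly_ring ?V)"
      using lead_exp_monomials[OF ord] Mc by (auto simp: lead_mono_eq intro!: Monom_carrier)
    \<comment> \<open>The chain is refined by \<open>?L\<close>, the ideal of the leading monomials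
      of the minors themselves, because the Groebner property is a statement about
      \<open>?L\<close>.\<close>
    have "separated_ideal d r \<subseteq> ?L"
      unfolding separated_ideal_def
    proof (rule genideal_subset[OF ideal_genideal[OF Lc]], clarify)
      fix S assume S: "S \<in> separated_sets d r"
      obtain c where c: "c \<in> hankel_columns d r" "diag_monomial r c = squarefree_monomial S"
        using separated_set_eq_diagonal[OF S] by blast
      let ?g = "det (hankel_minor r c) :: (nat, 'k) mpoly"
      have lead: "is_lead ord ?g (squarefree_monomial S)"
        using is_lead_hankel_minor[OF assms(2) r c(1)] by (simp add: c(2))
      have "?g \<noteq> 0" using lead by (auto simp: is_lead_def)
      moreover have "lead_mono ord ?g = Monom (squarefree_monomial S)"
        by (simp add: lead_mono_eq lead_exp_eqI[OF ord lead])
      moreover have "?g \<in> ?M" unfolding minors_hankel using c(1) by blast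
      ultimately have "Monom (squarefree_monomial S) \<in> {lead_mono ord g |g. g \<in> ?M \<and> g \<noteq> 0}"
        by (intro CollectI exI[of _ ?g]) simp
      then show "Monom (squarefree_monomial S) \<in> ?L"
        by (rule subsetD[OF genideal_self[OF Lc]])
    qed
    moreover have "?L \<subseteq> initial_ideal ?V ord ?D"
      unfolding initial_ideal_def
    proof (rule genideal_mono)
      show "{lead_mono ord f |f. f \<in> ?D \<and> f \<noteq> 0} \<subseteq> carrier (mpoly_ring ?V)"
        using lead_exp_monomials[OF ord] ideal_carrier[OF D] by (auto simp: lead_mono_eq intro!: Monom_carrier)
    qed (use genideal_self[OF Mc] in blast)
    moreover have "initial_ideal ?V ord ?D \<subseteq> initial_ideal ?V ord (secant_ideal ?V ?I r)"
      unfolding initial_ideal_def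
    proof (rule genideal_mono)
      show "{lead_mono ord f |f. f \<in> secant_ideal ?V ?I r \<and> f \<noteq> 0} \<subseteq> carrier (mpoly_ring ?V)"
        using lead_exp_monomials[OF ord] ideal_carrier[OF J] by (auto simp: lead_mono_eq intro!: Monom_carrier)
    qed (use DJ in blast)
    moreover have "initial_ideal ?V ord (secant_ideal ?V ?I r) \<subseteq> secant_ideal ?V (initial_ideal ?V ord ?I) r"
      by (rule initial_secant_ideal_subset[OF ord I r])
    moreover have "secant_ideal ?V (initial_ideal ?V ord ?I) r \<subseteq> secant_ideal ?V (separated_ideal d 1) r"
      by (rule secant_ideal_mono[OF initial_hankel_ideal_subset[OF assms(2)] ideal_separated_ideal r])
    moreover have "secant_ideal ?V (separated_ideal d 1) r \<subseteq> (separated_ideal d r :: (nat, 'k) mpoly set)"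
      by (rule secant_separated_ideal_subset[OF r])
    \<comment> \<open>The inclusions start and end at \<open>separated_ideal d r\<close>, so all
      ideals in between are equal.\<close>
    ultimately have eq: "initial_ideal ?V ord (secant_ideal ?V ?I r) = secant_ideal ?V (initial_ideal ?V ord ?I) r"
      "initial_ideal ?V ord (secant_ideal ?V ?I r) = ?L"
      "initial_ideal ?V ord (secant_ideal ?V ?I r) \<subseteq> initial_ideal ?V ord ?D"
      by blast+
    have "?D = secant_ideal ?V ?I r"
      by (rule ideal_eq_of_initial_ideal_subset[OF ord _ D J DJ eq(3)]) simp
    moreover have "finite ?M"
    proof -
      have "square_submatrices (r + 1) (hankel d r :: (nat, 'k) mpoly mat) \<subseteq>
        (\<lambda>(I, J). submatrix (hankel d r) I J) ` (Pow {..<dim_row (hankel d r :: (nat, 'k) mpoly mat)}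
          \<times> Pow {..<dim_col (hankel d r :: (nat, 'k) mpoly mat)})"
        by (auto simp: square_submatrices_def)
      then have "finite (square_submatrices (r + 1) (hankel d r :: (nat, 'k) mpoly mat))"
        by (rule finite_subset) simp
      then show ?thesis by (simp add: minors_def)
    qed
    ultimately show ?thesis using eq MJ by (simp add: groebner_basis_def)
  qed
  then show ?thesis by (simp add: delightful_def)
qed

end
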